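(* Let $\{G_n\}_{n\in\mathbb{N}}=\{(V_n,E_n)\}_{n\in\mathbb{N}}$ be an increasing sequence of finite graphs, $\{\alpha_n\}_{n\in\mathbb{N}}$ a sequence of positive real numbers, and $f_n:\{0,1\}^{V_n}\to\{-1,1\}$ a sequence of functions. Then for any $t,s>0$, $\lim_{n\to\infty}N(f_n,t,G_n,\alpha_n)=0$ if and only if $\lim_{n\to\infty}N(f_n,s,G_n,\alpha_n)=0$.
   Context: Symmetric exclusion process on $(G_n,\alpha_n)$: to every edge $e\in E_n$ associate an independent Poisson clock of rate $\alpha_n$; when the clock of $e$ rings, the endpoints of $e$ are interchanged. Let $\pi^n_t$ be the random permutation of $V_n$ obtained by composing, in the order of occurrence, all transpositions that occurred up to time $t$. Let $\eta^n_0\in\{0,1\}^{V_n}$ be uniformly distributed (i.i.d. Bernoulli$(1/2)$ coordinates), independent of the clocks, and put $\eta^n_t(x)=\eta^n_0((\pi^n_t)^{-1}(x))$ for $x\in V_n$. Define $$N(f_n,t,G_n,\alpha_n):=\mathbb{E}[f_n(\eta^n_0)f_n(\eta^n_t)]-\mathbb{E}[f_n(\eta^n_0)]^2 .$$ *)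

theory Defs
  imports "HOL-Probability.Probability" "HOL-Combinatorics.Transposition"
begin

definition finite_graph :: "'v set \<Rightarrow> 'v set set \<Rightarrow> bool" where
  "finite_graph V E \<longleftrightarrow> finite V \<and> (\<forall>e\<in>E. e \<subseteq> V \<and> card e = 2)"

definition configs :: "'v set \<Rightarrow> ('v \<Rightarrow> nat) set" where
  "configs V = V \<rightarrow>\<^sub>E {0, 1}"

text \<open>A clock is a random set of ring times; only the rings at positive times matter.\<close>

definition ring_count :: "('w \<Rightarrow> real set) \<Rightarrow> real \<Rightarrow> real \<Rightarrow> 'w \<Rightarrow> nat" where
  "ring_count T a b \<omega> = card (T \<omega> \<inter> {a<..b})"

text \<open>The last condition is independence of the increments over finitely many consecutive
  intervals: independence of the whole family means independence of its finite subfamilies.\<close>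

definition poisson_clock :: "'w measure \<Rightarrow> real \<Rightarrow> ('w \<Rightarrow> real set) \<Rightarrow> bool" where
  "poisson_clock M \<alpha> T \<longleftrightarrow>
     (\<forall>\<omega>\<in>space M. \<forall>t. finite (T \<omega> \<inter> {0<..t})) \<and>
     (\<forall>a b. 0 \<le> a \<longrightarrow> a < b \<longrightarrow>
        ring_count T a b \<in> measurable M (count_space UNIV) \<and>
        distr M (count_space UNIV) (ring_count T a b) = measure_pmf (poisson_pmf (\<alpha> * (b - a)))) \<and>
     (\<forall>u :: nat \<Rightarrow> real. 0 \<le> u 0 \<longrightarrow> mono u \<longrightarrow>
        prob_space.indep_vars M (\<lambda>_. count_space UNIV)
          (\<lambda>i. ring_count T (u i) (u (Suc i))) UNIV)"

text \<open>The counting path of a clock, as a random element of the product space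
  of functions from the reals to the naturals.\<close>

abbreviation path_space :: "(real \<Rightarrow> nat) measure" where
  "path_space \<equiv> PiM UNIV (\<lambda>_. count_space UNIV)"

definition ring_path :: "('w \<Rightarrow> real set) \<Rightarrow> 'w \<Rightarrow> real \<Rightarrow> nat" where
  "ring_path T \<omega> = (\<lambda>t. ring_count T 0 t \<omega>)"

text \<open>The randomness driving the process: mutually independent Poisson clocks of rate \<open>\<alpha>\<close>, one for
  each edge, and a uniformly distributed initial configuration independent of all of them.\<close>

definition exclusion_process ::
  "'w measure \<Rightarrow> 'v set \<Rightarrow> 'v set set \<Rightarrow> real \<Rightarrow> ('v set \<Rightarrow> 'w \<Rightarrow> real set) \<Rightarrow> ('w \<Rightarrow> 'v \<Rightarrow> nat) \<Rightarrow> bool"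
where
  "exclusion_process M V E \<alpha> clock \<eta>0 \<longleftrightarrow>
     prob_space M \<and>
     (\<forall>e\<in>E. poisson_clock M \<alpha> (clock e)) \<and>
     prob_space.indep_vars M (\<lambda>_. path_space) (\<lambda>e. ring_path (clock e)) E \<and>
     \<eta>0 \<in> measurable M (count_space (configs V)) \<and>
     distr M (count_space (configs V)) \<eta>0 = uniform_count_measure (configs V) \<and>
     prob_space.indep_set M
       (sets (vimage_algebra (space M) (\<lambda>\<omega>. \<lambda>e\<in>E. ring_path (clock e) \<omega>) (PiM E (\<lambda>_. path_space))))
       (sets (vimage_algebra (space M) \<eta>0 (count_space (configs V))))"

definition edge_swap :: "'v set \<Rightarrow> 'v \<Rightarrow> 'v" where
  "edge_swap e = (THE p. \<exists>x y. e = {x, y} \<and> p = Transposition.transpose x y)"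

lemma edge_swap_doubleton: "edge_swap {x, y} = Transposition.transpose x y"
  unfolding edge_swap_def
  by (rule the_equality) (auto simp: doubleton_eq_iff transpose_commute)

text \<open>Almost surely no two clocks ring simultaneously, so the convention made here for that case
  (nothing is moved) is immaterial.\<close>

definition swap_at :: "'v set set \<Rightarrow> ('v set \<Rightarrow> 'w \<Rightarrow> real set) \<Rightarrow> 'w \<Rightarrow> real \<Rightarrow> 'v \<Rightarrow> 'v" where
  "swap_at E clock \<omega> r =
     (if \<exists>!e. e \<in> E \<and> r \<in> clock e \<omega> then edge_swap (THE e. e \<in> E \<and> r \<in> clock e \<omega>) else id)"

text \<open>The permutation \<open>\<pi>\<^sub>t\<close>: transpositions at later times are applied after those at earlier ones.
  It is the identity outside the vertex set.\<close>

definition exclusion_perm :: "'v set set \<Rightarrow> ('v set \<Rightarrow> 'w \<Rightarrow> real set) \<Rightarrow> real \<Rightarrow> 'w \<Rightarrow> 'v \<Rightarrow> 'v" where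
  "exclusion_perm E clock t \<omega> =
     fold (\<lambda>r p. swap_at E clock \<omega> r \<circ> p)
       (sorted_list_of_set (\<Union>e\<in>E. clock e \<omega> \<inter> {0<..t})) id"

definition exclusion_config ::
  "'v set \<Rightarrow> 'v set set \<Rightarrow> ('v set \<Rightarrow> 'w \<Rightarrow> real set) \<Rightarrow> ('w \<Rightarrow> 'v \<Rightarrow> nat) \<Rightarrow> real \<Rightarrow> 'w \<Rightarrow> 'v \<Rightarrow> nat"
where
  "exclusion_config V E clock \<eta>0 t \<omega> = (\<lambda>x\<in>V. \<eta>0 \<omega> (inv (exclusion_perm E clock t \<omega>) x))"

text \<open>\<open>N(f, t, G, \<alpha>)\<close>. The rate \<open>\<alpha>\<close> enters through the law of the clocks.\<close>

definition exclusion_N ::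
  "'w measure \<Rightarrow> 'v set \<Rightarrow> 'v set set \<Rightarrow> ('v set \<Rightarrow> 'w \<Rightarrow> real set) \<Rightarrow> ('w \<Rightarrow> 'v \<Rightarrow> nat)
    \<Rightarrow> (('v \<Rightarrow> nat) \<Rightarrow> real) \<Rightarrow> real \<Rightarrow> real"
where
  "exclusion_N M V E clock \<eta>0 f t =
     (\<integral>\<omega>. f (\<eta>0 \<omega>) * f (exclusion_config V E clock \<eta>0 t \<omega>) \<partial>M) - (\<integral>\<omega>. f (\<eta>0 \<omega>) \<partial>M)\<^sup>2"

end

theory Submission
  imports Defs "HOL-Combinatorics.Permutations"
begin

text \<open>Cut the time interval into \<open>n\<close> pieces and keep only the event that every piece contains at most
  one ring, whose probability tends to one. On this event the process performs \<open>n\<close> steps of a lazy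
  random walk on configurations, whose transition operator \<open>K\<close> is self-adjoint; hence \<open>N(t)\<close> is the limit
  of \<open>\<langle>g, K\<^sup>n g\<rangle>\<close>, where \<open>g\<close> is the centred function. Since \<open>\<langle>g, K\<^sup>2\<^sup>n g\<rangle> = \<parallel>K\<^sup>n g\<parallel>\<^sup>2\<close>, the function \<open>N\<close> is
  nonnegative, and \<open>N(t/2)\<^sup>2 \<le> N(t)\<close> by Cauchy--Schwarz. As \<open>K\<close> with more laziness contracts less,
  \<open>N\<close> is also decreasing. So convergence to zero at \<open>t\<close> passes to \<open>t/2\<^sup>k\<close> for every \<open>k\<close> and from there to
  all larger times.\<close>

section \<open>Averaging over edge swaps\<close>

lemma edge_swapE:
  assumes "finite_graph V E" "e \<in> E"
  obtains x y where "x \<noteq> y" "x \<in> V" "y \<in> V" "e = {x, y}" "edge_swap e = Transposition.transpose x y"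
proof -
  from assms have "e \<subseteq> V" "card e = 2"
    by (auto simp: finite_graph_def)
  then obtain x y where "e = {x, y}" "x \<noteq> y"
    by (auto simp: card_2_iff)
  with \<open>e \<subseteq> V\<close> show thesis
    by (intro that[of x y]) (auto simp: edge_swap_doubleton)
qed

lemma edge_swap_involutory:
  assumes "finite_graph V E" "e \<in> E"
  shows "edge_swap e \<circ> edge_swap e = id"
  using assms by (auto elim!: edge_swapE)

lemma finite_graph_edges: "finite_graph V E \<Longrightarrow> finite E"
  by (rule finite_subset[of _ "Pow V"]) (auto simp: finite_graph_def)

lemma finite_configs: "finite V \<Longrightarrow> finite (configs V)"
  by (auto simp: configs_def intro: finite_PiE)

lemma card_configs_pos: "finite V \<Longrightarrow> card (configs V) > 0"
  by (auto simp: card_gt_0_iff finite_configs) (auto simp: configs_def PiE_eq_empty_iff)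

lemma configs_comp_edge_swap:
  assumes "finite_graph V E" "e \<in> E" "c \<in> configs V"
  shows "c \<circ> edge_swap e \<in> configs V"
proof -
  obtain x y where "x \<in> V" "y \<in> V" "edge_swap e = Transposition.transpose x y"
    using edge_swapE[OF assms(1,2)] by metis
  with assms(3) show ?thesis
    by (auto simp: configs_def PiE_iff extensional_def Transposition.transpose_def)
qed

lemma configs_comp_edge_swap_bij:
  assumes "finite_graph V E" "e \<in> E"
  shows "bij_betw (\<lambda>c. c \<circ> edge_swap e) (configs V) (configs V)"
  by (rule bij_betw_byWitness[where f' = "\<lambda>c. c \<circ> edge_swap e"])
     (use configs_comp_edge_swap[OF assms] edge_swap_involutory[OF assms] in
       \<open>auto simp: comp_assoc\<close>)

section \<open>Averaging operators and the uniform inner product\<close>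

definition edge_average :: "'v set set \<Rightarrow> (('v \<Rightarrow> nat) \<Rightarrow> real) \<Rightarrow> ('v \<Rightarrow> nat) \<Rightarrow> real" where
  "edge_average E g c = (\<Sum>e\<in>E. g (c \<circ> edge_swap e)) / card E"

text \<open>Transition operator of the walk that stays put with probability \<open>1 - w\<close> and
  otherwise swaps along a uniformly chosen edge. For empty \<open>E\<close> the division makes the
  average 0, so constants are then fixed only if \<open>w = 0\<close>; later lemmas carry this as a
  premise.\<close>

definition lazy_average :: "'v set set \<Rightarrow> real \<Rightarrow> (('v \<Rightarrow> nat) \<Rightarrow> real) \<Rightarrow> ('v \<Rightarrow> nat) \<Rightarrow> real" where
  "lazy_average E w g c = (1 - w) * g c + w * edge_average E g c"

text \<open>The inner product of square-integrable functions under the law of the initial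
  configuration; pairing with the constant 1 gives the mean.\<close>

definition config_inner :: "'v set \<Rightarrow> (('v \<Rightarrow> nat) \<Rightarrow> real) \<Rightarrow> (('v \<Rightarrow> nat) \<Rightarrow> real) \<Rightarrow> real" where
  "config_inner V f g = (\<Sum>c\<in>configs V. f c * g c) / card (configs V)"

lemma config_inner_commute: "config_inner V f g = config_inner V g f"
  by (simp add: config_inner_def mult.commute)

lemma config_inner_self_nonneg: "config_inner V f f \<ge> 0"
  by (auto simp: config_inner_def intro!: divide_nonneg_nonneg sum_nonneg)

lemma config_inner_linear_right:
  "config_inner V f (\<lambda>c. a * g c + b * h c) = a * config_inner V f g + b * config_inner V f h"
  by (simp add: config_inner_def algebra_simps sum.distrib sum_distrib_left add_divide_distrib)

lemma config_inner_linear_left: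
  "config_inner V (\<lambda>c. a * g c + b * h c) f = a * config_inner V g f + b * config_inner V h f"
  by (metis config_inner_commute config_inner_linear_right)

lemma config_inner_Cauchy_Schwarz:
  "(config_inner V f g)\<^sup>2 \<le> config_inner V f f * config_inner V g g"
  using Cauchy_Schwarz_ineq_sum[of f g "configs V"]
  by (auto simp: config_inner_def power_divide power2_eq_square divide_right_mono)

lemma config_inner_le_1:
  assumes "finite V" "\<And>c. c \<in> configs V \<Longrightarrow> \<bar>f c\<bar> \<le> 1" "\<And>c. c \<in> configs V \<Longrightarrow> \<bar>g c\<bar> \<le> 1"
  shows "\<bar>config_inner V f g\<bar> \<le> 1"
proof -
  have "\<bar>\<Sum>c\<in>configs V. f c * g c\<bar> \<le> (\<Sum>c\<in>configs V. \<bar>f c * g c\<bar>)"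
    by (rule sum_abs)
  also have "\<dots> \<le> (\<Sum>c\<in>configs V. 1)"
    by (intro sum_mono) (auto simp: abs_mult intro!: mult_le_one assms)
  finally show ?thesis
    using card_configs_pos[OF assms(1)] by (simp add: config_inner_def)
qed

text \<open>Each swap is an involution of the configuration space, so reindexing the sum by it moves
  the swap from one factor to the other.\<close>

lemma edge_average_symmetric:
  assumes "finite_graph V E"
  shows "config_inner V f (edge_average E g) = config_inner V (edge_average E f) g"
proof -
  have "(\<Sum>c\<in>configs V. f c * g (c \<circ> edge_swap e)) = (\<Sum>c\<in>configs V. f (c \<circ> edge_swap e) * g c)"
    if "e \<in> E" for e
    using edge_swap_involutory[OF assms that]
    by (subst sum.reindex_bij_betw[OF configs_comp_edge_swap_bij[OF assms that], symmetric])
       (simp add: comp_assoc)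
  then have "(\<Sum>e\<in>E. \<Sum>c\<in>configs V. f c * g (c \<circ> edge_swap e))
    = (\<Sum>e\<in>E. \<Sum>c\<in>configs V. f (c \<circ> edge_swap e) * g c)"
    by simp
  then show ?thesis
    by (subst (asm) (1 2) sum.swap)
       (simp add: config_inner_def edge_average_def sum_distrib_left sum_distrib_right
         flip: sum_divide_distrib)
qed

text \<open>Jensen's inequality bounds the squared average pointwise by the average of the square,
  and averaging preserves the uniform mean.\<close>

lemma edge_average_contraction:
  assumes "finite_graph V E"
  shows "config_inner V (edge_average E g) (edge_average E g) \<le> config_inner V g g"
proof (cases "E = {}")
  case True
  then show ?thesis
    using config_inner_self_nonneg[of V g] by (simp add: config_inner_def edge_average_def)
next
  case False
  have E: "card E > 0"
    using False finite_graph_edges[OF assms] by (simp add: card_gt_0_iff)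
  have "(edge_average E g c)\<^sup>2 \<le> edge_average E (\<lambda>c. (g c)\<^sup>2) c" for c
  proof -
    have "(\<Sum>e\<in>E. g (c \<circ> edge_swap e))\<^sup>2 \<le> card E * (\<Sum>e\<in>E. (g (c \<circ> edge_swap e))\<^sup>2)"
      using Cauchy_Schwarz_ineq_sum[of "\<lambda>_. 1" "\<lambda>e. g (c \<circ> edge_swap e)" E] by simp
    then show ?thesis
      using E by (simp add: edge_average_def field_simps power2_eq_square)
  qed
  then have "config_inner V (edge_average E g) (edge_average E g)
      \<le> config_inner V (\<lambda>_. 1) (edge_average E (\<lambda>c. (g c)\<^sup>2))"
    by (auto simp: config_inner_def power2_eq_square intro!: divide_right_mono sum_mono)
  \<comment> \<open>Symmetry transfers the average to the constant 1, which it fixes because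
    \<open>E\<close> is nonempty here.\<close>
  also have "\<dots> = config_inner V (edge_average E (\<lambda>_. 1)) (\<lambda>c. (g c)\<^sup>2)"
    by (rule edge_average_symmetric[OF assms])
  also have "\<dots> = config_inner V g g"
    using E by (simp add: config_inner_def edge_average_def power2_eq_square)
  finally show ?thesis .
qed

lemma config_inner_lazy_average_right:
  "config_inner V f (lazy_average E w g) =
    (1 - w) * config_inner V f g + w * config_inner V f (edge_average E g)"
  unfolding lazy_average_def[abs_def] by (rule config_inner_linear_right)

lemma config_inner_lazy_average_left:
  "config_inner V (lazy_average E w f) g =
    (1 - w) * config_inner V f g + w * config_inner V (edge_average E f) g"
  unfolding lazy_average_def[abs_def] by (rule config_inner_linear_left)

lemma lazy_average_symmetric:
  assumes "finite_graph V E"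
  shows "config_inner V f (lazy_average E w g) = config_inner V (lazy_average E w f) g"
  by (simp add: config_inner_lazy_average_left config_inner_lazy_average_right edge_average_symmetric[OF assms])

lemma lazy_average_power_symmetric:
  assumes "finite_graph V E"
  shows "config_inner V f ((lazy_average E w ^^ n) g) = config_inner V ((lazy_average E w ^^ n) f) g"
proof (induction n arbitrary: f)
  case (Suc n)
  then show ?case
    by (simp add: lazy_average_symmetric[OF assms]) (simp add: funpow_swap1)
qed simp

text \<open>Symmetry moves half of the steps to the left factor, turning a correlation over an even
  number of steps into a squared norm.\<close>

lemma lazy_average_power_double:
  assumes "finite_graph V E"
  shows "config_inner V g ((lazy_average E w ^^ (2 * n)) g) =
    config_inner V ((lazy_average E w ^^ n) g) ((lazy_average E w ^^ n) g)"
  by (simp add: mult_2 funpow_add lazy_average_power_symmetric[OF assms, of g])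

lemma edge_average_linear:
  "edge_average E (\<lambda>c. a * g c + b * h c) c = a * edge_average E g c + b * edge_average E h c"
  by (simp add: edge_average_def sum.distrib sum_distrib_left add_divide_distrib)

text \<open>Both operators are combinations of the identity and the same edge average. Commutation
  makes it possible to change the laziness one step at a time.\<close>

lemma lazy_average_commute: "lazy_average E w (lazy_average E v g) = lazy_average E v (lazy_average E w g)"
proof -
  have "edge_average E (lazy_average E u g) c =
      (1 - u) * edge_average E g c + u * edge_average E (edge_average E g) c" for u c
    unfolding lazy_average_def[abs_def] by (rule edge_average_linear)
  then show ?thesis
    by (simp add: fun_eq_iff lazy_average_def[of E w "lazy_average E v g"]
        lazy_average_def[of E v "lazy_average E w g"])
       (simp add: lazy_average_def algebra_simps)
qed

lemma lazy_average_power_commute: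
  "(lazy_average E w ^^ n) (lazy_average E v g) = lazy_average E v ((lazy_average E w ^^ n) g)"
  by (induction n) (simp_all add: lazy_average_commute[of E w])

text \<open>The squared norm is a quadratic polynomial in the laziness parameter; since the average is a
  contraction, this polynomial is decreasing up to \<open>1/2\<close>.\<close>

lemma lazy_average_antimono:
  assumes "finite_graph V E" "0 \<le> v" "v \<le> w" "w \<le> 1/2"
  shows "config_inner V (lazy_average E w g) (lazy_average E w g)
    \<le> config_inner V (lazy_average E v g) (lazy_average E v g)"
proof -
  let ?A = "edge_average E g"
  define a b d where abd: "a = config_inner V g g" "b = config_inner V g ?A" "d = config_inner V ?A ?A"
  have expand: "config_inner V (lazy_average E u g) (lazy_average E u g)
      = (1 - u)\<^sup>2 * a + 2 * u * (1 - u) * b + u\<^sup>2 * d" for u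
    unfolding abd
    by (simp add: config_inner_lazy_average_left config_inner_lazy_average_right config_inner_commute[of V ?A g]
        power2_eq_square algebra_simps)
  \<comment> \<open>The squared norm of the difference of \<open>g\<close> and \<open>?A\<close>,
    written so that bilinearity applies. Its nonnegativity is the convexity of the quadratic in
    \<open>u\<close>.\<close>
  have "config_inner V (\<lambda>c. 1 * g c + (- 1) * ?A c) (\<lambda>c. 1 * g c + (- 1) * ?A c) = a - 2 * b + d"
    unfolding abd by (simp only: config_inner_linear_left config_inner_linear_right)
      (simp add: config_inner_commute[of V ?A g])
  then have "0 \<le> a - 2 * b + d"
    using config_inner_self_nonneg by metis
  moreover have "d \<le> a"
    unfolding abd by (rule edge_average_contraction[OF assms(1)])
  moreover have "0 \<le> 1 - (w + v)" "0 \<le> w - v"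
    using assms by auto
  \<comment> \<open>The product is the squared norm at \<open>v\<close> minus the one at
    \<open>w\<close>, factored; the bound \<open>w \<le> 1/2\<close> enters through the sign of
    \<open>1 - (w + v)\<close>.\<close>
  ultimately have "0 \<le> (w - v) * ((1 - (w + v)) * (a - 2 * b + d) + (a - d))"
    by (metis add_nonneg_nonneg diff_ge_0_iff_ge mult_nonneg_nonneg)
  then show ?thesis
    unfolding expand by (simp add: power2_eq_square algebra_simps)
qed

text \<open>The outermost step is changed from \<open>w\<close> to \<open>v\<close> by the one-step
  comparison and then commuted to the innermost place; the induction hypothesis, general in
  \<open>g\<close>, changes the remaining steps.\<close>

lemma lazy_average_power_antimono:
  assumes "finite_graph V E" "0 \<le> v" "v \<le> w" "w \<le> 1/2"
  shows "config_inner V ((lazy_average E w ^^ n) g) ((lazy_average E w ^^ n) g)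
    \<le> config_inner V ((lazy_average E v ^^ n) g) ((lazy_average E v ^^ n) g)"
proof (induction n arbitrary: g)
  case (Suc n)
  have "config_inner V ((lazy_average E w ^^ Suc n) g) ((lazy_average E w ^^ Suc n) g)
    \<le> config_inner V ((lazy_average E w ^^ n) (lazy_average E v g)) ((lazy_average E w ^^ n) (lazy_average E v g))"
    using lazy_average_antimono[OF assms] by (simp add: lazy_average_power_commute)
  also have "\<dots> \<le> config_inner V ((lazy_average E v ^^ Suc n) g) ((lazy_average E v ^^ Suc n) g)"
    using Suc.IH[of "lazy_average E v g"] by (simp add: funpow_swap1)
  finally show ?case .
qed simp

lemma lazy_average_power_shift:
  assumes "E = {} \<Longrightarrow> w = 0" "finite E"
  shows "(lazy_average E w ^^ n) (\<lambda>c. g c - m) = (\<lambda>c. (lazy_average E w ^^ n) g c - m)"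
proof (induction n)
  case (Suc n)
  have "lazy_average E w (\<lambda>c. h c - m) c = lazy_average E w h c - m" for h c
    using assms
    by (cases "E = {}") (simp_all add: lazy_average_def edge_average_def sum_subtractf field_simps)
  with Suc show ?case
    by simp
qed simp

lemma lazy_average_power_const:
  assumes "E = {} \<Longrightarrow> w = 0" "finite E"
  shows "(lazy_average E w ^^ n) (\<lambda>_. 1) = (\<lambda>_. 1)"
proof (induction n)
  case (Suc n)
  have "lazy_average E w (\<lambda>_. 1) = (\<lambda>_. 1)"
    using assms by (cases "E = {}") (auto simp: lazy_average_def edge_average_def fun_eq_iff)
  with Suc show ?case
    by simp
qed simp

lemma lazy_average_power_bounded:
  assumes "finite_graph V E" "0 \<le> w" "w \<le> 1" "\<And>c. c \<in> configs V \<Longrightarrow> \<bar>g c\<bar> \<le> 1" "c \<in> configs V"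
  shows "\<bar>(lazy_average E w ^^ n) g c\<bar> \<le> 1"
  using assms(5)
proof (induction n arbitrary: c)
  case (Suc n)
  let ?h = "(lazy_average E w ^^ n) g"
  have "\<bar>\<Sum>e\<in>E. ?h (c \<circ> edge_swap e)\<bar> \<le> (\<Sum>e\<in>E. \<bar>?h (c \<circ> edge_swap e)\<bar>)"
    by (rule sum_abs)
  also have "\<dots> \<le> (\<Sum>e\<in>E. 1)"
    using Suc configs_comp_edge_swap[OF assms(1)] by (intro sum_mono) auto
  finally have "\<bar>edge_average E ?h c\<bar> \<le> 1"
    by (cases "card E = 0") (simp_all add: edge_average_def)
  then have "w * \<bar>edge_average E ?h c\<bar> \<le> w * 1" "(1 - w) * \<bar>?h c\<bar> \<le> (1 - w) * 1"
    using Suc assms(2,3) by (intro mult_left_mono; simp)+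
  then have "\<bar>(1 - w) * ?h c\<bar> + \<bar>w * edge_average E ?h c\<bar> \<le> 1"
    using assms(2,3) by (simp add: abs_mult)
  then show ?case
    using abs_triangle_ineq[of "(1 - w) * ?h c" "w * edge_average E ?h c"]
    by (simp add: lazy_average_def[of E w ?h])
qed (use assms(4) in simp)

text \<open>The powers fix constants and are symmetric, so \<open>?K f\<close> has the same mean
  \<open>m\<close> as \<open>f\<close>, and all terms with \<open>m\<close> add up to
  \<open>- m\<^sup>2\<close>. Covariances thus become correlations of one fixed vector, to which
  norm arguments apply.\<close>

lemma config_inner_centered:
  assumes "finite_graph V E" "E = {} \<Longrightarrow> w = 0" and m: "m = config_inner V f (\<lambda>_. 1)"
  shows "config_inner V (\<lambda>c. f c - m) ((lazy_average E w ^^ n) (\<lambda>c. f c - m))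
    = config_inner V f ((lazy_average E w ^^ n) f) - m\<^sup>2"
proof -
  let ?K = "lazy_average E w ^^ n"
  note finE = finite_graph_edges[OF assms(1)]
  have "finite V" using assms(1) by (simp add: finite_graph_def)
  note pos = card_configs_pos[OF this]
  have one: "config_inner V (\<lambda>_. 1) (\<lambda>_. 1) = 1"
    using pos by (simp add: config_inner_def)
  have "?K (\<lambda>_. 1) = (\<lambda>_. 1)"
    using assms(2) finE by (rule lazy_average_power_const)
  then have mean: "config_inner V (\<lambda>_. 1) (?K f) = m"
    by (simp add: lazy_average_power_symmetric[OF assms(1)] m config_inner_commute[of _ f])
  have "config_inner V (\<lambda>c. f c - m) ((lazy_average E w ^^ n) (\<lambda>c. f c - m))
      = config_inner V (\<lambda>c. 1 * f c + (- m) * 1) (\<lambda>c. 1 * ?K f c + (- m) * 1)"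
    by (simp add: lazy_average_power_shift[OF assms(2) finE])
  also have "\<dots> = config_inner V f (?K f) - m\<^sup>2"
    unfolding config_inner_linear_left config_inner_linear_right
    using one mean m config_inner_commute[of V f "\<lambda>_. 1"]
    by (simp add: power2_eq_square)
  finally show ?thesis .
qed

section \<open>Discretising the permutation\<close>

text \<open>Counterpart of \<open>swap_at\<close> for a whole interval, with the same convention if
  several edges ring. It sees the clocks only through ring counts, whose law is prescribed.\<close>

definition interval_swap ::
  "'v set set \<Rightarrow> ('v set \<Rightarrow> 'w \<Rightarrow> real set) \<Rightarrow> real \<Rightarrow> real \<Rightarrow> 'w \<Rightarrow> 'v \<Rightarrow> 'v" where
  "interval_swap E clock a b \<omega> =
     (if \<exists>!e. e \<in> E \<and> ring_count (clock e) a b \<omega> \<noteq> 0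
      then edge_swap (THE e. e \<in> E \<and> ring_count (clock e) a b \<omega> \<noteq> 0) else id)"

definition discrete_perm ::
  "'v set set \<Rightarrow> ('v set \<Rightarrow> 'w \<Rightarrow> real set) \<Rightarrow> (nat \<Rightarrow> real) \<Rightarrow> nat \<Rightarrow> 'w \<Rightarrow> 'v \<Rightarrow> 'v" where
  "discrete_perm E clock u k \<omega> =
     fold (\<lambda>i p. interval_swap E clock (u i) (u (Suc i)) \<omega> \<circ> p) [0..<k] id"

lemma sorted_list_of_set_Un:
  fixes A B :: "'a::linorder set"
  assumes "finite A" "finite B" "\<And>x y. x \<in> A \<Longrightarrow> y \<in> B \<Longrightarrow> x < y"
  shows "sorted_list_of_set (A \<union> B) = sorted_list_of_set A @ sorted_list_of_set B"
proof -
  let ?l = "sorted_list_of_set A @ sorted_list_of_set B"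
  have "sorted ?l" "distinct ?l" "set ?l = A \<union> B"
    using assms by (auto simp: sorted_append less_imp_le)
  then show ?thesis
    by (metis sorted_list_of_set.idem_if_sorted_distinct)
qed

lemma exclusion_perm_split:
  assumes "finite E" "\<And>e. e \<in> E \<Longrightarrow> finite (clock e \<omega> \<inter> {0<..b})" "0 \<le> a" "a \<le> b"
  shows "exclusion_perm E clock b \<omega> =
    fold (\<lambda>r p. swap_at E clock \<omega> r \<circ> p)
      (sorted_list_of_set (\<Union>e\<in>E. clock e \<omega> \<inter> {a<..b})) (exclusion_perm E clock a \<omega>)"
proof -
  have split: "(\<Union>e\<in>E. clock e \<omega> \<inter> {0<..b})
      = (\<Union>e\<in>E. clock e \<omega> \<inter> {0<..a}) \<union> (\<Union>e\<in>E. clock e \<omega> \<inter> {a<..b})"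
    using assms(3,4) by fastforce
  have fin: "finite (\<Union>e\<in>E. clock e \<omega> \<inter> {0<..b})"
    using assms(1,2) by (rule finite_UN_I)
  have "sorted_list_of_set (\<Union>e\<in>E. clock e \<omega> \<inter> {0<..b}) =
    sorted_list_of_set (\<Union>e\<in>E. clock e \<omega> \<inter> {0<..a}) @ sorted_list_of_set (\<Union>e\<in>E. clock e \<omega> \<inter> {a<..b})"
    unfolding split using fin[unfolded split] by (intro sorted_list_of_set_Un) auto
  then show ?thesis
    by (simp add: exclusion_perm_def)
qed

text \<open>The premise \<open>single\<close> restricts ring times, not edges: if several edges ring
  at \<open>r\<close>, then \<open>swap_at\<close> and \<open>interval_swap\<close> both default to
  the identity, so the identity holds pointwise even there.\<close>

lemma exclusion_perm_step:
  assumes "finite E" "\<And>e. e \<in> E \<Longrightarrow> finite (clock e \<omega> \<inter> {0<..b})" "0 \<le> a" "a \<le> b"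
    and single: "(\<Union>e\<in>E. clock e \<omega> \<inter> {a<..b}) \<subseteq> {r}"
  shows "exclusion_perm E clock b \<omega> = interval_swap E clock a b \<omega> \<circ> exclusion_perm E clock a \<omega>"
proof -
  have "finite (clock e \<omega> \<inter> {a<..b})" if "e \<in> E" for e
    using assms(2)[OF that] by (rule rev_finite_subset) (use assms(3) in auto)
  then have count: "ring_count (clock e) a b \<omega> \<noteq> 0 \<longleftrightarrow> clock e \<omega> \<inter> {a<..b} \<noteq> {}" if "e \<in> E" for e
    using that by (simp add: ring_count_def)
  note split = exclusion_perm_split[of E clock \<omega> b a, OF assms(1) assms(2) assms(3,4)]
  show ?thesis
  proof (cases "(\<Union>e\<in>E. clock e \<omega> \<inter> {a<..b}) = {}")
    case True
    then have none: "\<not> (e \<in> E \<and> ring_count (clock e) a b \<omega> \<noteq> 0)" for e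
      using count by blast
    show ?thesis
      using split none unfolding True interval_swap_def by auto
  next
    case False
    with single have eq: "(\<Union>e\<in>E. clock e \<omega> \<inter> {a<..b}) = {r}"
      by blast
    then have "e \<in> E \<and> ring_count (clock e) a b \<omega> \<noteq> 0 \<longleftrightarrow> e \<in> E \<and> r \<in> clock e \<omega>" for e
      using count[of e] by (cases "e \<in> E") (auto simp: set_eq_iff)
    then have "interval_swap E clock a b \<omega> = swap_at E clock \<omega> r"
      unfolding interval_swap_def swap_at_def by simp
    then show ?thesis
      using split unfolding eq by simp
  qed
qed

lemma exclusion_perm_eq_discrete_perm:
  assumes "finite E" "\<And>e x. e \<in> E \<Longrightarrow> finite (clock e \<omega> \<inter> {0<..x})"
    and "mono u" "u 0 = 0"
    and "\<And>i. i < k \<Longrightarrow> \<exists>r. (\<Union>e\<in>E. clock e \<omega> \<inter> {u i<..u (Suc i)}) \<subseteq> {r}"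
  shows "exclusion_perm E clock (u k) \<omega> = discrete_perm E clock u k \<omega>"
  using assms(5)
proof (induction k)
  case 0
  then show ?case
    by (simp add: exclusion_perm_def discrete_perm_def assms(4))
next
  case (Suc k)
  obtain r where r: "(\<Union>e\<in>E. clock e \<omega> \<inter> {u k<..u (Suc k)}) \<subseteq> {r}"
    using Suc.prems by blast
  have "0 \<le> u k" "u k \<le> u (Suc k)"
    using monoD[OF assms(3), of 0 k] monoD[OF assms(3), of k "Suc k"] assms(4) by auto
  from exclusion_perm_step[of E clock \<omega> "u (Suc k)" "u k", OF assms(1) assms(2) this r] Suc
  show ?case
    by (simp add: discrete_perm_def)
qed

text \<open>Distinct points have positive distance while the mesh tends to 0, and finitely many
  pairs admit a common threshold.\<close>

lemma eventually_grid_separates: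
  fixes R :: "real set"
  assumes "finite R"
  shows "\<forall>\<^sub>F n in sequentially. \<forall>i. \<exists>r. R \<inter> {real i * (t / n)<..real (Suc i) * (t / n)} \<subseteq> {r}"
proof -
  have "\<forall>\<^sub>F n in sequentially. x \<noteq> y \<longrightarrow> t / real n < \<bar>x - y\<bar>" for x y
  proof (cases "x = y")
    case False
    have "(\<lambda>n. t / real n) \<longlonglongrightarrow> 0"
      by (rule lim_const_over_n)
    then show ?thesis
      using order_tendstoD(2)[of _ 0 _ "\<bar>x - y\<bar>"] False by (auto elim: eventually_mono)
  qed simp
  then have "\<forall>\<^sub>F n in sequentially. \<forall>x\<in>R. \<forall>y\<in>R. x \<noteq> y \<longrightarrow> t / real n < \<bar>x - y\<bar>"
    using assms by (simp add: eventually_ball_finite_distrib)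
  then show ?thesis
  proof eventually_elim
    case (elim n)
    show ?case
    proof
      fix i
      have "x = y" if "x \<in> R \<inter> {real i * (t / n)<..real (Suc i) * (t / n)}"
        "y \<in> R \<inter> {real i * (t / n)<..real (Suc i) * (t / n)}" for x y
      proof (rule ccontr)
        assume "x \<noteq> y"
        then have "t / n < \<bar>x - y\<bar>"
          using elim that by blast
        moreover have "real (Suc i) * (t / n) = real i * (t / n) + t / n"
          unfolding of_nat_Suc by (simp only: distrib_right mult_1_left add.commute)
        ultimately show False
          using that by (simp only: Int_iff greaterThanAtMost_iff) linarith
      qed
      then show "\<exists>r. R \<inter> {real i * (t / n)<..real (Suc i) * (t / n)} \<subseteq> {r}"
        by blast
    qed
  qed
qed

section \<open>Label sequences and the expansion of powers of the walk\<close>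

fun label_swap :: "'v set option \<Rightarrow> 'v \<Rightarrow> 'v" where
  "label_swap None = id"
| "label_swap (Some e) = edge_swap e"

abbreviation edge_labels :: "'v set set \<Rightarrow> 'v set option set" where
  "edge_labels E \<equiv> insert None (Some ` E)"

text \<open>Configurations are transported by the inverse permutation, so the earliest swap stands
  next to the configuration and the list is consumed from its head.\<close>

fun label_act :: "'v set option list \<Rightarrow> ('v \<Rightarrow> nat) \<Rightarrow> 'v \<Rightarrow> nat" where
  "label_act [] c = c"
| "label_act (l # ls) c = label_act ls (c \<circ> label_swap l)"

lemma label_swap_involutory:
  assumes "finite_graph V E" "l \<in> edge_labels E"
  shows "label_swap l \<circ> label_swap l = id"
  using assms edge_swap_involutory by (cases l) auto

lemma label_act_in_configs:
  assumes "finite_graph V E" "set ls \<subseteq> edge_labels E" "c \<in> configs V"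
  shows "label_act ls c \<in> configs V"
  using assms(2,3)
proof (induction ls arbitrary: c)
  case (Cons l ls)
  then have "c \<circ> label_swap l \<in> configs V"
    using configs_comp_edge_swap[OF assms(1)] by (cases l) auto
  with Cons show ?case
    by simp
qed simp

text \<open>Inversion reverses the composition built by the fold, and every swap is its own inverse.
  The general start \<open>p\<close> is what the induction needs.\<close>

lemma comp_inv_fold_label_swap:
  assumes "finite_graph V E" "set ls \<subseteq> edge_labels E" "bij p"
  shows "c \<circ> inv (fold (\<lambda>l p. label_swap l \<circ> p) ls p) = label_act ls (c \<circ> inv p)"
  using assms(2,3)
proof (induction ls arbitrary: p)
  case (Cons l ls)
  have inv: "label_swap l \<circ> label_swap l = id"
    using Cons.prems by (intro label_swap_involutory[OF assms(1)]) auto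
  then have "bij (label_swap l)"
    by (simp add: o_bij)
  moreover from inv this have "inv (label_swap l) = label_swap l"
    by (simp add: inv_unique_comp)
  ultimately have "c \<circ> inv (label_swap l \<circ> p) = c \<circ> inv p \<circ> label_swap l" "bij (label_swap l \<circ> p)"
    using Cons.prems by (simp_all add: bij_comp o_inv_distrib comp_assoc)
  then show ?case
    using Cons.IH[of "label_swap l \<circ> p"] Cons.prems
    by (simp only: fold_simps label_act.simps list.set insert_subset)
qed simp

text \<open>The labels record, interval by interval, the unique ringing edge, if there is one.\<close>

definition follows_labels ::
  "'v set set \<Rightarrow> ('v set \<Rightarrow> 'w \<Rightarrow> real set) \<Rightarrow> real \<Rightarrow> 'v set option list \<Rightarrow> 'w \<Rightarrow> bool" where
  "follows_labels E clock h ls \<omega> \<longleftrightarrow> (\<forall>i<length ls. \<forall>e\<in>E.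
     ring_count (clock e) (real i * h) (real (Suc i) * h) \<omega> = (if ls ! i = Some e then 1 else 0))"

text \<open>The prescribed counts leave at most one ring per interval, so the discretised
  permutation is exact; they also identify the swap of each interval with its label.\<close>

lemma exclusion_perm_follows_labels:
  assumes "finite E" "\<And>e x. e \<in> E \<Longrightarrow> finite (clock e \<omega> \<inter> {0<..x})"
    and "0 \<le> h" "set ls \<subseteq> edge_labels E"
    and ls: "follows_labels E clock h ls \<omega>"
  shows "exclusion_perm E clock (real (length ls) * h) \<omega> = fold (\<lambda>l p. label_swap l \<circ> p) ls id"
proof -
  define u where "u = (\<lambda>i. real i * h)"
  have u: "mono u" "u 0 = 0"
    using assms(3) by (auto simp: u_def mono_def intro: mult_right_mono)
  have u_nonneg: "0 \<le> u i" for i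
    using assms(3) by (simp add: u_def)
  have count: "ring_count (clock e) (u i) (u (Suc i)) \<omega> = (if ls ! i = Some e then 1 else 0)"
    if "i < length ls" "e \<in> E" for i e
    using ls that by (simp add: follows_labels_def u_def)
  have fin: "finite (clock e \<omega> \<inter> {u i<..u (Suc i)})" if "e \<in> E" for e i
    using assms(2)[OF that, of "u (Suc i)"]
    by (rule rev_finite_subset) (use u_nonneg[of i] in auto)
  have single: "\<exists>r. (\<Union>e\<in>E. clock e \<omega> \<inter> {u i<..u (Suc i)}) \<subseteq> {r}" if i: "i < length ls" for i
  proof -
    have empty: "clock e \<omega> \<inter> {u i<..u (Suc i)} = {}" if "e \<in> E" "ls ! i \<noteq> Some e" for e
      using count[OF i that(1)] that fin by (simp add: ring_count_def)
    show ?thesis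
    proof (cases "\<exists>e\<in>E. ls ! i = Some e")
      case True
      then obtain e where e: "e \<in> E" "ls ! i = Some e"
        by blast
      then obtain r where "clock e \<omega> \<inter> {u i<..u (Suc i)} = {r}"
        using count[OF i e(1)] by (auto simp: ring_count_def card_1_singleton_iff)
      moreover have "clock e' \<omega> \<inter> {u i<..u (Suc i)} = {}" if "e' \<in> E" "e' \<noteq> e" for e'
        using empty[OF that(1)] that e by simp
      ultimately have "clock e' \<omega> \<inter> {u i<..u (Suc i)} \<subseteq> {r}" if "e' \<in> E" for e'
        using that by (cases "e' = e") simp_all
      then show ?thesis
        by (intro exI[of _ r] UN_least)
    next
      case False
      \<comment> \<open>No edge rings in this interval, so any singleton would do; \<open>0\<close>
        is an arbitrary choice.\<close>
      then have "clock e \<omega> \<inter> {u i<..u (Suc i)} \<subseteq> {0}" if "e \<in> E" for e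
        using empty[OF that] that by simp
      then show ?thesis
        by (intro exI[of _ 0] UN_least)
    qed
  qed
  have swap: "interval_swap E clock (u i) (u (Suc i)) \<omega> = label_swap (ls ! i)"
    if i: "i < length ls" for i
  proof -
    have iff: "e \<in> E \<and> ring_count (clock e) (u i) (u (Suc i)) \<omega> \<noteq> 0 \<longleftrightarrow> ls ! i = Some e" for e
      using count[OF i, of e] nth_mem[OF i] assms(4) by (auto split: if_splits)
    show ?thesis
      unfolding interval_swap_def iff by (cases "ls ! i") auto
  qed
  have "exclusion_perm E clock (u (length ls)) \<omega> = discrete_perm E clock u (length ls) \<omega>"
    by (rule exclusion_perm_eq_discrete_perm[OF assms(1) _ u]) (use assms(2) single in auto)
  also have "\<dots> = fold (\<lambda>i p. label_swap (ls ! i) \<circ> p) [0..<length ls] id"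
    unfolding discrete_perm_def by (rule fold_cong) (auto simp: swap)
  also have "\<dots> = fold (\<lambda>l p. label_swap l \<circ> p) (map ((!) ls) [0..<length ls]) id"
    by (simp only: fold_map o_def[of "\<lambda>l p. label_swap l \<circ> p" "(!) ls"])
  also have "map ((!) ls) [0..<length ls] = ls"
    by (rule map_nth)
  finally show ?thesis
    by (simp only: u_def)
qed

lemma exclusion_config_follows_labels:
  assumes "finite_graph V E" "\<And>e x. e \<in> E \<Longrightarrow> finite (clock e \<omega> \<inter> {0<..x})"
    and "0 \<le> h" "set ls \<subseteq> edge_labels E" "follows_labels E clock h ls \<omega>" "\<eta>0 \<omega> \<in> configs V"
  shows "exclusion_config V E clock \<eta>0 (real (length ls) * h) \<omega> = label_act ls (\<eta>0 \<omega>)"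
proof -
  have "label_act ls (\<eta>0 \<omega>) \<in> extensional V"
    using label_act_in_configs[OF assms(1,4,6)] by (auto simp: configs_def PiE_def)
  moreover have "exclusion_config V E clock \<eta>0 (real (length ls) * h) \<omega>
      = restrict (\<eta>0 \<omega> \<circ> inv (exclusion_perm E clock (real (length ls) * h) \<omega>)) V"
    by (simp add: exclusion_config_def comp_def)
  ultimately show ?thesis
    using comp_inv_fold_label_swap[OF assms(1,4) bij_id, of "\<eta>0 \<omega>"]
      exclusion_perm_follows_labels[of E clock \<omega> h ls, OF finite_graph_edges[OF assms(1)] assms(2) assms(3-5)]
    by (simp only: inv_id comp_id extensional_restrict)
qed

text \<open>Below, \<open>r\<close> is the probability that at most one ring occurs in an interval of the grid, and \<open>w\<close> the
  conditional probability that there is one.\<close>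

definition label_weight :: "'v set set \<Rightarrow> real \<Rightarrow> real \<Rightarrow> 'v set option \<Rightarrow> real" where
  "label_weight E r w l = r * (case l of None \<Rightarrow> 1 - w | Some e \<Rightarrow> w / card E)"

definition label_lists :: "'v set set \<Rightarrow> nat \<Rightarrow> 'v set option list set" where
  "label_lists E n = {ls. set ls \<subseteq> edge_labels E \<and> length ls = n}"

lemma finite_label_lists: "finite E \<Longrightarrow> finite (label_lists E n)"
  unfolding label_lists_def by (rule finite_lists_length_eq) simp

text \<open>Path expansion of a power of the transition operator: weights multiply along the list,
  so splitting off the first label peels off one step and one factor \<open>r\<close>. The start
  \<open>c\<close> is general because the first label moves it.\<close>

lemma sum_label_weight:
  assumes "finite E"
  shows "(\<Sum>ls\<in>label_lists E n. prod_list (map (label_weight E r w) ls) * g (label_act ls c))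
    = r ^ n * (lazy_average E w ^^ n) g c"
proof (induction n arbitrary: c)
  case 0
  have "label_lists E 0 = {[]}"
    by (auto simp: label_lists_def)
  then show ?case
    by simp
next
  case (Suc n)
  let ?W = "\<lambda>ls. prod_list (map (label_weight E r w) ls)"
  have lists: "label_lists E (Suc n) = (\<lambda>(l, ls). l # ls) ` (edge_labels E \<times> label_lists E n)"
    by (auto simp: label_lists_def length_Suc_conv image_iff)
  have "(\<Sum>ls\<in>label_lists E (Suc n). ?W ls * g (label_act ls c))
      = (\<Sum>(l, ls)\<in>edge_labels E \<times> label_lists E n. ?W (l # ls) * g (label_act (l # ls) c))"
    unfolding lists by (subst sum.reindex) (auto simp: inj_on_def case_prod_unfold)
  also have "\<dots> = (\<Sum>l\<in>edge_labels E. label_weight E r w l *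
      (\<Sum>ls\<in>label_lists E n. ?W ls * g (label_act ls (c \<circ> label_swap l))))"
    by (simp add: sum.cartesian_product[symmetric] sum_distrib_left mult.assoc)
  also have "\<dots> = (\<Sum>l\<in>edge_labels E. label_weight E r w l *
      (r ^ n * (lazy_average E w ^^ n) g (c \<circ> label_swap l)))"
    by (simp only: Suc.IH)
  also have "\<dots> = r ^ Suc n * (lazy_average E w ^^ Suc n) g c"
  proof -
    let ?h = "(lazy_average E w ^^ n) g"
    have "(\<Sum>l\<in>edge_labels E. label_weight E r w l * (r ^ n * ?h (c \<circ> label_swap l)))
        = r * (1 - w) * (r ^ n * ?h c) + (\<Sum>e\<in>E. r * (w / card E) * (r ^ n * ?h (c \<circ> edge_swap e)))"
      using assms by (simp add: sum.reindex label_weight_def)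
    also have "(\<Sum>e\<in>E. r * (w / card E) * (r ^ n * ?h (c \<circ> edge_swap e)))
        = r ^ Suc n * (w * edge_average E ?h c)"
      by (simp add: edge_average_def sum_distrib_left sum_divide_distrib mult_ac)
    also have "r * (1 - w) * (r ^ n * ?h c) + r ^ Suc n * (w * edge_average E ?h c)
        = r ^ Suc n * lazy_average E w ?h c"
      by (simp add: lazy_average_def[of E w ?h] algebra_simps)
    also have "lazy_average E w ?h = (lazy_average E w ^^ Suc n) g"
      by simp
    finally show ?thesis .
  qed
  finally show ?case .
qed

lemma exclusion_perm_permutes:
  assumes "finite_graph V E"
  shows "exclusion_perm E clock t \<omega> permutes V"
proof -
  have swap: "swap_at E clock \<omega> r permutes V" for r
  proof (cases "\<exists>!e. e \<in> E \<and> r \<in> clock e \<omega>")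
    case True
    from theI'[OF this] have "(THE e. e \<in> E \<and> r \<in> clock e \<omega>) \<in> E"
      by blast
    then have "edge_swap (THE e. e \<in> E \<and> r \<in> clock e \<omega>) permutes V"
      by (rule edge_swapE[OF assms]) (simp add: permutes_swap_id)
    with True show ?thesis
      by (simp add: swap_at_def)
  qed (simp add: swap_at_def permutes_id)
  have "fold (\<lambda>r p. swap_at E clock \<omega> r \<circ> p) rs p permutes V" if "p permutes V" for rs p
    using that by (induction rs arbitrary: p) (auto intro: permutes_compose swap)
  then show ?thesis
    unfolding exclusion_perm_def by (simp add: permutes_id)
qed

lemma exclusion_config_in_configs:
  assumes "finite_graph V E" "\<eta>0 \<omega> \<in> configs V"
  shows "exclusion_config V E clock \<eta>0 t \<omega> \<in> configs V"
  using assms(2) permutes_in_image[OF permutes_inv[OF exclusion_perm_permutes[OF assms(1), of clock t \<omega>]]]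
  unfolding exclusion_config_def configs_def by (auto simp: PiE_iff simp del: One_nat_def)

lemma label_lists_nth: "ls \<in> label_lists E n \<Longrightarrow> i < n \<Longrightarrow> ls ! i \<in> edge_labels E"
  unfolding label_lists_def by (metis (mono_tags, lifting) mem_Collect_eq nth_mem subsetD)

section \<open>The law of the discretised process\<close>

locale exclusion =
  fixes M :: "'w measure" and V :: "'v set" and E :: "'v set set" and \<alpha> :: real
    and clock :: "'v set \<Rightarrow> 'w \<Rightarrow> real set" and \<eta>0 :: "'w \<Rightarrow> 'v \<Rightarrow> nat"
  assumes graph: "finite_graph V E" and rate: "\<alpha> > 0"
    and process: "exclusion_process M V E \<alpha> clock \<eta>0"

sublocale exclusion \<subseteq> prob_space M
  using process by (simp add: exclusion_process_def)

context exclusion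
begin

lemma finite_V: "finite V"
  using graph by (simp add: finite_graph_def)

lemmas finite_E = finite_graph_edges[OF graph]

lemma clock: "e \<in> E \<Longrightarrow> poisson_clock M \<alpha> (clock e)"
  using process by (simp add: exclusion_process_def)

lemma finite_rings: "e \<in> E \<Longrightarrow> \<omega> \<in> space M \<Longrightarrow> finite (clock e \<omega> \<inter> {0<..x})"
  using clock by (simp add: poisson_clock_def)

lemma ring_count_measurable:
  "e \<in> E \<Longrightarrow> 0 \<le> a \<Longrightarrow> a < b \<Longrightarrow> ring_count (clock e) a b \<in> measurable M (count_space UNIV)"
  using clock unfolding poisson_clock_def by blast

lemma initial_measurable: "\<eta>0 \<in> measurable M (count_space (configs V))"
  using process by (simp add: exclusion_process_def)

lemma initial_in_configs: "\<omega> \<in> space M \<Longrightarrow> \<eta>0 \<omega> \<in> configs V"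
  using measurable_space[OF initial_measurable] by simp

lemma simple_function_initial: "simple_function M \<eta>0"
  unfolding simple_function_def
proof safe
  show "finite (\<eta>0 ` space M)"
    by (rule finite_subset[OF _ finite_configs[OF finite_V]]) (auto simp: initial_in_configs)
  show "\<eta>0 -` {\<eta>0 \<omega>} \<inter> space M \<in> sets M" if "\<omega> \<in> space M" for \<omega>
    by (rule measurable_sets[OF initial_measurable]) (use initial_in_configs[OF that] in simp)
qed

text \<open>The swap depends only on the set of ringing edges, a random subset of the finite set
  \<open>E\<close> whose level sets are finite intersections of ring count events.\<close>

lemma simple_function_interval_swap:
  assumes "0 \<le> a" "a < b"
  shows "simple_function M (interval_swap E clock a b)"
proof -
  let ?S = "\<lambda>\<omega>. {e \<in> E. ring_count (clock e) a b \<omega> \<noteq> 0}"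
  have "simple_function M ?S"
    unfolding simple_function_def
  proof safe
    show "finite (?S ` space M)"
      by (rule finite_subset[of _ "Pow E"]) (auto simp: finite_E)
    fix \<omega>0
    have "?S -` {?S \<omega>0} \<inter> space M =
      {\<omega> \<in> space M. \<forall>e\<in>E. ring_count (clock e) a b \<omega> \<in> (if e \<in> ?S \<omega>0 then {0<..} else {0})}"
      by (auto simp: set_eq_iff split: if_splits)
        (metis neq0_conv)+
    also have "\<dots> \<in> sets M"
    proof (rule sets.sets_Collect_finite_All[OF _ finite_E])
      fix e assume "e \<in> E"
      from measurable_sets[OF ring_count_measurable[OF this assms]]
      show "{\<omega> \<in> space M. ring_count (clock e) a b \<omega> \<in> (if e \<in> ?S \<omega>0 then {0<..} else {0})} \<in> sets M"
        by (simp add: vimage_def Int_def conj_commute)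
    qed
    finally show "?S -` {?S \<omega>0} \<inter> space M \<in> sets M" .
  qed
  then have "simple_function M ((\<lambda>A. if \<exists>!e. e \<in> A then edge_swap (THE e. e \<in> A) else id) \<circ> ?S)"
    by (rule simple_function_compose)
  also have "((\<lambda>A. if \<exists>!e. e \<in> A then edge_swap (THE e. e \<in> A) else id) \<circ> ?S) = interval_swap E clock a b"
    by (simp add: fun_eq_iff interval_swap_def)
  finally show ?thesis .
qed

lemma simple_function_discrete_perm:
  assumes "strict_mono u" "u 0 = 0"
  shows "simple_function M (discrete_perm E clock u k)"
proof (induction k)
  case 0
  have "discrete_perm E clock u 0 = (\<lambda>_. id)"
    by (simp add: discrete_perm_def fun_eq_iff)
  then show ?case
    by simp
next
  case (Suc k)
  have "0 \<le> u k" "u k < u (Suc k)"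
    using strict_mono_mono[OF assms(1), THEN monoD, of 0 k] strict_monoD[OF assms(1), of k "Suc k"] assms(2)
    by auto
  then have "simple_function M (\<lambda>\<omega>. interval_swap E clock (u k) (u (Suc k)) \<omega> \<circ> discrete_perm E clock u k \<omega>)"
    by (intro simple_function_compose2[of _ _ _ "(\<circ>)"] simple_function_interval_swap Suc)
  also have "(\<lambda>\<omega>. interval_swap E clock (u k) (u (Suc k)) \<omega> \<circ> discrete_perm E clock u k \<omega>)
      = discrete_perm E clock u (Suc k)"
    unfolding discrete_perm_def by simp
  finally show ?case .
qed

text \<open>No null set has to be discarded here: at every sample point, the permutation agrees with its
  discretisation on all sufficiently fine grids, even where clocks ring simultaneously.\<close>

lemma config_measurable:
  assumes "t > 0"
  shows "(\<lambda>\<omega>. g (exclusion_config V E clock \<eta>0 t \<omega>) :: real) \<in> borel_measurable M"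
proof (rule borel_measurable_LIMSEQ_real)
  define u where "u n i = real i * (t / real n)" for n i
  \<comment> \<open>The shift to \<open>Suc n\<close> keeps the mesh positive and the grid strictly
    increasing.\<close>
  let ?X = "\<lambda>n \<omega>. g (\<lambda>x\<in>V. \<eta>0 \<omega> (inv (discrete_perm E clock (u (Suc n)) (Suc n) \<omega>) x))"
  show "?X n \<in> borel_measurable M" for n
  proof -
    have "strict_mono (u (Suc n))" "u (Suc n) 0 = 0"
      using assms by (auto simp: u_def strict_mono_def intro!: divide_strict_right_mono)
    then have "simple_function M (discrete_perm E clock (u (Suc n)) (Suc n))"
      by (rule simple_function_discrete_perm)
    from simple_function_compose2[OF simple_function_initial this, of "\<lambda>c p. g (\<lambda>x\<in>V. c (inv p x))"]
    show ?thesis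
      by (rule borel_measurable_simple_function)
  qed
  fix \<omega> assume \<omega>: "\<omega> \<in> space M"
  define R where "R = (\<Union>e\<in>E. clock e \<omega> \<inter> {0<..t})"
  have "finite R"
    unfolding R_def using finite_E finite_rings[OF _ \<omega>] by (rule finite_UN_I)
  then have "\<forall>\<^sub>F n in sequentially. \<forall>i. \<exists>r. R \<inter> {u (Suc n) i<..u (Suc n) (Suc i)} \<subseteq> {r}"
    unfolding u_def by (intro eventually_sequentially_Suc[THEN iffD2] eventually_grid_separates)
  then have "\<forall>\<^sub>F n in sequentially. ?X n \<omega> = g (exclusion_config V E clock \<eta>0 t \<omega>)"
  proof eventually_elim
    case (elim n)
    have t: "u (Suc n) (Suc n) = t"
      by (simp add: u_def)
    have u: "mono (u (Suc n))" "u (Suc n) 0 = 0"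
      using assms by (auto simp: u_def mono_def intro!: divide_right_mono)
    have "exclusion_perm E clock (u (Suc n) (Suc n)) \<omega> = discrete_perm E clock (u (Suc n)) (Suc n) \<omega>"
    proof (rule exclusion_perm_eq_discrete_perm[OF finite_E _ u])
      show "finite (clock e \<omega> \<inter> {0<..x})" if "e \<in> E" for e x
        using that \<omega> by (rule finite_rings)
      fix i assume "i < Suc n"
      then have "u (Suc n) (Suc i) \<le> t" "0 \<le> u (Suc n) i"
        using monoD[OF u(1), of "Suc i" "Suc n"] monoD[OF u(1), of 0 i] t u(2) by auto
      then have sub: "{u (Suc n) i<..u (Suc n) (Suc i)} \<subseteq> {0<..t}"
        by auto
      then have "(\<Union>e\<in>E. clock e \<omega> \<inter> {u (Suc n) i<..u (Suc n) (Suc i)})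
          = R \<inter> {u (Suc n) i<..u (Suc n) (Suc i)}"
        unfolding R_def by blast
      then show "\<exists>r. (\<Union>e\<in>E. clock e \<omega> \<inter> {u (Suc n) i<..u (Suc n) (Suc i)}) \<subseteq> {r}"
        using elim by simp
    qed
    then show ?case
      by (simp only: exclusion_config_def t)
  qed
  then show "(\<lambda>n. ?X n \<omega>) \<longlonglongrightarrow> g (exclusion_config V E clock \<eta>0 t \<omega>)"
    by (rule tendsto_eventually)
qed

section \<open>Poisson weights of the grid intervals\<close>

definition "total_rate = \<alpha> * card E"
text \<open>For a Poisson count of mean \<open>total_rate * h\<close>,
  \<open>single_weight h\<close> is the probability of a value at most 1, and
  \<open>ring_weight h\<close> the conditional probability of the value 1 given this.\<close>

definition "ring_weight h = total_rate * h / (1 + total_rate * h)"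
definition "single_weight h = exp (- (total_rate * h)) * (1 + total_rate * h)"

lemma total_rate_nonneg: "total_rate \<ge> 0"
  using rate by (simp add: total_rate_def)

lemma prob_ring_count:
  assumes "e \<in> E" "0 \<le> a" "a < b"
  shows "prob (ring_count (clock e) a b -` {k} \<inter> space M) = pmf (poisson_pmf (\<alpha> * (b - a))) k"
proof -
  have "distr M (count_space UNIV) (ring_count (clock e) a b) = measure_pmf (poisson_pmf (\<alpha> * (b - a)))"
    using clock[OF assms(1)] assms(2,3) unfolding poisson_clock_def by blast
  then have "measure (distr M (count_space UNIV) (ring_count (clock e) a b)) {k}
      = pmf (poisson_pmf (\<alpha> * (b - a))) k"
    by (simp add: pmf.rep_eq)
  then show ?thesis
    by (simp add: measure_distr[OF ring_count_measurable[OF assms]])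
qed

lemma clock_increments_indep:
  fixes u :: "nat \<Rightarrow> real"
  assumes "e \<in> E" "0 \<le> u 0" "mono u"
  shows "indep_vars (\<lambda>_. count_space UNIV) (\<lambda>i. ring_count (clock e) (u i) (u (Suc i))) UNIV"
  using clock[OF assms(1), unfolded poisson_clock_def, THEN conjunct2, THEN conjunct2, rule_format, of u]
    assms(2,3) by simp

lemma prob_ring_counts:
  assumes "e \<in> E" "h > 0" "n > 0"
  shows "prob {\<omega>\<in>space M. \<forall>i<n. ring_count (clock e) (real i * h) (real (Suc i) * h) \<omega> = k i}
    = (\<Prod>i<n. pmf (poisson_pmf (\<alpha> * h)) (k i))"
proof -
  let ?X = "\<lambda>i. ring_count (clock e) (real i * h) (real (Suc i) * h)"
  have "mono (\<lambda>i. real i * h)" "0 \<le> real 0 * h"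
    using assms(2) by (auto simp: mono_def intro: mult_right_mono)
  then have indep: "indep_vars (\<lambda>_. count_space UNIV) ?X UNIV"
    using clock_increments_indep[OF assms(1), of "\<lambda>i. real i * h"] by simp
  have "{\<omega>\<in>space M. \<forall>i<n. ?X i \<omega> = k i} = (\<Inter>i\<in>{..<n}. ?X i -` {k i} \<inter> space M)"
    using assms(3) by auto
  also have "prob \<dots> = (\<Prod>i<n. prob (?X i -` {k i} \<inter> space M))"
    using assms(3) by (intro indep_varsD[OF indep]) auto
  also have "\<dots> = (\<Prod>i<n. pmf (poisson_pmf (\<alpha> * h)) (k i))"
  proof (rule prod.cong[OF refl])
    fix i
    have "real (Suc i) * h - real i * h = h"
      by (simp add: algebra_simps)
    then show "prob (?X i -` {k i} \<inter> space M) = pmf (poisson_pmf (\<alpha> * h)) (k i)"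
      using prob_ring_count[OF assms(1), of "real i * h" "real (Suc i) * h" "k i"] assms(2) by simp
  qed
  finally show ?thesis .
qed

text \<open>Independence between edges is given for counting paths, so increments have to be read
  off from the paths. Natural-number subtraction is exact because the paths are nondecreasing on
  nonnegative times.\<close>

lemma ring_count_eq_path_diff:
  assumes "e \<in> E" "\<omega> \<in> space M" "0 \<le> a" "a \<le> b"
  shows "ring_count (clock e) a b \<omega> = ring_path (clock e) \<omega> b - ring_path (clock e) \<omega> a"
proof -
  have "finite (clock e \<omega> \<inter> {0<..b})"
    by (rule finite_rings[OF assms(1,2)])
  moreover have "clock e \<omega> \<inter> {0<..b} = (clock e \<omega> \<inter> {0<..a}) \<union> (clock e \<omega> \<inter> {a<..b})"
    using assms(3,4) by fastforce
  moreover have "(clock e \<omega> \<inter> {0<..a}) \<inter> (clock e \<omega> \<inter> {a<..b}) = {}"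
    by auto
  ultimately have "card (clock e \<omega> \<inter> {0<..b}) = card (clock e \<omega> \<inter> {0<..a}) + card (clock e \<omega> \<inter> {a<..b})"
    by (metis card_Un_disjoint finite_Un)
  then show ?thesis
    by (simp add: ring_path_def ring_count_def)
qed

text \<open>At most one edge has count 1, so the product is the exponential of the total rate times
  1 or \<open>\<alpha> * h\<close>. Dividing by the probability of at most one ring leaves
  \<open>1 - w\<close> or \<open>w / card E\<close>.\<close>

lemma pmf_poisson_label:
  assumes "h > 0" "l \<in> edge_labels E"
  shows "(\<Prod>e\<in>E. pmf (poisson_pmf (\<alpha> * h)) (if l = Some e then 1 else 0))
    = label_weight E (single_weight h) (ring_weight h) l"
proof -
  have pos: "0 < \<alpha> * h" "0 < 1 + total_rate * h"
    using rate assms(1) total_rate_nonneg by (auto intro!: add_pos_nonneg)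
  have pmf: "pmf (poisson_pmf (\<alpha> * h)) (if l = Some e then 1 else 0)
      = exp (- (\<alpha> * h)) * (if l = Some e then \<alpha> * h else 1)" for e
    using pos by simp
  have exp: "exp (- (\<alpha> * h)) ^ card E = exp (- (total_rate * h))"
    by (simp add: total_rate_def exp_of_nat_mult[symmetric] mult_ac)
  have "(\<Prod>e\<in>E. pmf (poisson_pmf (\<alpha> * h)) (if l = Some e then 1 else 0))
      = exp (- (total_rate * h)) * (\<Prod>e\<in>E. if l = Some e then \<alpha> * h else 1)"
    unfolding pmf prod.distrib prod_constant exp ..
  also have "\<dots> = label_weight E (single_weight h) (ring_weight h) l"
  proof (cases l)
    case None
    have "1 - ring_weight h = 1 / (1 + total_rate * h)"
      using pos by (simp add: ring_weight_def field_simps)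
    then show ?thesis
      using None pos by (simp add: label_weight_def single_weight_def)
  next
    case (Some e)
    then have "e \<in> E"
      using assms(2) by auto
    then have "card E > 0" "E \<noteq> {}"
      using finite_E by (auto simp: card_gt_0_iff)
    then show ?thesis
      using pos Some \<open>e \<in> E\<close> finite_E
      by (simp add: label_weight_def single_weight_def ring_weight_def prod.delta)
        (simp add: total_rate_def)
  qed
  finally show ?thesis .
qed

definition label_event :: "real \<Rightarrow> 'v set option list \<Rightarrow> ('v \<Rightarrow> nat) \<Rightarrow> 'w set" where
  "label_event h ls c = {\<omega>\<in>space M. follows_labels E clock h ls \<omega> \<and> \<eta>0 \<omega> = c}"

lemma prob_initial:
  assumes "c \<in> configs V"
  shows "prob (\<eta>0 -` {c} \<inter> space M) = 1 / card (configs V)"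
proof -
  have "distr M (count_space (configs V)) \<eta>0 = uniform_count_measure (configs V)"
    using process by (simp add: exclusion_process_def)
  then have "measure (distr M (count_space (configs V)) \<eta>0) {c} = 1 / card (configs V)"
    using assms by (simp add: measure_uniform_count_measure finite_configs finite_V)
  then show ?thesis
    using assms by (simp add: measure_distr[OF initial_measurable])
qed

text \<open>Three independences factor the probability: of the initial configuration from all
  clocks, of the clocks of different edges, and of the increments of a single clock.\<close>

lemma prob_label_event:
  assumes "h > 0" "n > 0" "ls \<in> label_lists E n" "c \<in> configs V"
  shows "label_event h ls c \<in> events"
    and "prob (label_event h ls c) =
      prod_list (map (label_weight E (single_weight h) (ring_weight h)) ls) / card (configs V)"
proof -
  define k where "k e i = (if ls ! i = Some e then 1 else 0 :: nat)" for e i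
  \<comment> \<open>Paths with the prescribed increments; only finitely many coordinates are
    involved, so the set is measurable in \<open>path_space\<close>.\<close>
  define B where "B e = {p :: real \<Rightarrow> nat. \<forall>i<n. p (real (Suc i) * h) - p (real i * h) = k e i}" for e
  define P where "P = (\<lambda>\<omega>. \<lambda>e\<in>E. ring_path (clock e) \<omega>)"
  have len: "length ls = n"
    using assms(3) by (simp add: label_lists_def)
  have B: "B e \<in> sets path_space" for e
  proof -
    have "{p \<in> space path_space. \<forall>i\<in>{..<n}. p (real (Suc i) * h) - p (real i * h) = k e i} \<in> sets path_space"
      by (intro sets.sets_Collect_finite_All) (auto intro!: measurable_equality_set measurable_component_singleton)
    then show ?thesis
      by (simp add: B_def space_PiM lessThan_def)
  qed
  have path: "ring_path (clock e) \<omega> \<in> B e \<longleftrightarrow>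
      (\<forall>i<n. ring_count (clock e) (real i * h) (real (Suc i) * h) \<omega> = k e i)"
    if "e \<in> E" "\<omega> \<in> space M" for e \<omega>
    using assms(1) by (simp add: B_def ring_count_eq_path_diff[OF that] mult_right_mono)
  have indep: "indep_vars (\<lambda>_. path_space) (\<lambda>e. ring_path (clock e)) E"
    using process by (simp add: exclusion_process_def)
  have indep_initial: "indep_set
       (sets (vimage_algebra (space M) P (PiM E (\<lambda>_. path_space))))
       (sets (vimage_algebra (space M) \<eta>0 (count_space (configs V))))"
    using process by (simp add: exclusion_process_def P_def)
  let ?D = "{\<omega>\<in>space M. follows_labels E clock h ls \<omega>}"
  have D: "?D = P -` (PiE E B) \<inter> space M"
  proof (rule set_eqI)
    fix \<omega>
    have "P \<omega> \<in> PiE E B \<longleftrightarrow> (\<forall>e\<in>E. ring_path (clock e) \<omega> \<in> B e)"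
      by (auto simp: P_def PiE_iff)
    then show "\<omega> \<in> ?D \<longleftrightarrow> \<omega> \<in> P -` (PiE E B) \<inter> space M"
      using path by (auto simp: follows_labels_def len k_def)
  qed
  have "?D \<in> sets (vimage_algebra (space M) P (PiM E (\<lambda>_. path_space)))"
    unfolding D by (rule in_vimage_algebra) (rule sets_PiM_I_finite[OF finite_E B])
  moreover have "\<eta>0 -` {c} \<inter> space M \<in> sets (vimage_algebra (space M) \<eta>0 (count_space (configs V)))"
    using assms(4) by (intro in_vimage_algebra) auto
  ultimately have *: "?D \<in> events" "prob (?D \<inter> (\<eta>0 -` {c} \<inter> space M)) = prob ?D * prob (\<eta>0 -` {c} \<inter> space M)"
    using indep_setD[OF indep_initial] indep_setD_ev1[OF indep_initial] by auto
  have event: "label_event h ls c = ?D \<inter> (\<eta>0 -` {c} \<inter> space M)"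
    by (auto simp: label_event_def)
  show "label_event h ls c \<in> events"
    unfolding event using *(1) measurable_sets[OF initial_measurable, of "{c}"] assms(4) by auto
  have "prob ?D = (\<Prod>e\<in>E. \<Prod>i<n. pmf (poisson_pmf (\<alpha> * h)) (k e i))"
  proof (cases "E = {}")
    \<comment> \<open>Without edges the event is the whole space; the product rule for independent
      variables is applied to a nonempty index set.\<close>
    case True
    then show ?thesis
      by (simp add: follows_labels_def prob_space)
  next
    case False
    have "?D = (\<Inter>e\<in>E. ring_path (clock e) -` B e \<inter> space M)"
      unfolding D using False by (auto simp: P_def)
    also have "prob \<dots> = (\<Prod>e\<in>E. prob (ring_path (clock e) -` B e \<inter> space M))"
      using False finite_E B by (intro indep_varsD[OF indep]) auto
    also have "\<dots> = (\<Prod>e\<in>E. \<Prod>i<n. pmf (poisson_pmf (\<alpha> * h)) (k e i))"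
    proof (rule prod.cong[OF refl])
      fix e assume e: "e \<in> E"
      have "ring_path (clock e) -` B e \<inter> space M =
          {\<omega>\<in>space M. \<forall>i<n. ring_count (clock e) (real i * h) (real (Suc i) * h) \<omega> = k e i}"
        using path[OF e] by auto
      then show "prob (ring_path (clock e) -` B e \<inter> space M) = (\<Prod>i<n. pmf (poisson_pmf (\<alpha> * h)) (k e i))"
        by (simp only: prob_ring_counts[OF e assms(1,2)])
    qed
    finally show ?thesis .
  qed
  \<comment> \<open>Regrouped by intervals, the Poisson factors of all edges combine into the weight
    of one label.\<close>
  also have "\<dots> = (\<Prod>i<n. \<Prod>e\<in>E. pmf (poisson_pmf (\<alpha> * h)) (k e i))"
    by (rule prod.swap)
  also have "\<dots> = (\<Prod>i<n. label_weight E (single_weight h) (ring_weight h) (ls ! i))"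
  proof (rule prod.cong[OF refl])
    fix i assume "i \<in> {..<n}"
    then have "ls ! i \<in> edge_labels E"
      using label_lists_nth[OF assms(3)] by simp
    then show "(\<Prod>e\<in>E. pmf (poisson_pmf (\<alpha> * h)) (k e i)) =
        label_weight E (single_weight h) (ring_weight h) (ls ! i)"
      unfolding k_def by (rule pmf_poisson_label[OF assms(1)])
  qed
  also have "\<dots> = prod_list (map (label_weight E (single_weight h) (ring_weight h)) ls)"
    by (simp add: prod.list_conv_set_nth len atLeast0LessThan)
  finally show "prob (label_event h ls c) =
      prod_list (map (label_weight E (single_weight h) (ring_weight h)) ls) / card (configs V)"
    unfolding event *(2) by (simp add: prob_initial[OF assms(4)])
qed

text \<open>A sample point determines its initial configuration and, in every interval, its label:
  the edge with count 1, or \<open>None\<close>.\<close>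

lemma label_event_disjoint:
  "disjoint_family_on (\<lambda>(ls, c). label_event h ls c) (label_lists E n \<times> configs V)"
proof -
  have eq: "ls = ls'" if "ls \<in> label_lists E n" "ls' \<in> label_lists E n"
    "follows_labels E clock h ls \<omega>" "follows_labels E clock h ls' \<omega>" for ls ls' \<omega>
  proof (rule nth_equalityI)
    show "length ls = length ls'"
      using that by (simp add: label_lists_def)
    fix i assume i: "i < length ls"
    then have iff: "ls ! i = Some e \<longleftrightarrow> ls' ! i = Some e" if "e \<in> E" for e
      using \<open>follows_labels E clock h ls \<omega>\<close> \<open>follows_labels E clock h ls' \<omega>\<close> \<open>length ls = length ls'\<close> that
      by (fastforce simp: follows_labels_def split: if_splits)
    have "ls ! i \<in> edge_labels E" "ls' ! i \<in> edge_labels E"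
      using label_lists_nth[OF that(1)] label_lists_nth[OF that(2)] that(1) i
      by (simp_all add: label_lists_def del: insert_iff)
    with iff show "ls ! i = ls' ! i"
      by (cases "ls ! i"; cases "ls' ! i") auto
  qed
  show ?thesis
    unfolding disjoint_family_on_def
    by (auto simp: label_event_def dest: eq)
qed

text \<open>On each labelled event the integrand is constant, and together these events contribute
  the weighted path sum. Elsewhere the integrand is bounded by 1, so the error is at most the
  probability of the remaining event.\<close>

lemma expectation_approx:
  assumes "t > 0" "n > 0"
    and f: "\<And>c. c \<in> configs V \<Longrightarrow> \<bar>f c\<bar> \<le> 1" and g: "\<And>c. c \<in> configs V \<Longrightarrow> \<bar>g c\<bar> \<le> 1"
  defines "h \<equiv> t / real n"
  shows "\<bar>expectation (\<lambda>\<omega>. f (\<eta>0 \<omega>) * g (exclusion_config V E clock \<eta>0 t \<omega>)) -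
      single_weight h ^ n * config_inner V f ((lazy_average E (ring_weight h) ^^ n) g)\<bar>
    \<le> 1 - single_weight h ^ n"
proof -
  define I where "I = label_lists E n \<times> configs V"
  define A where "A = (\<lambda>(ls, c). label_event h ls c)"
  define v where "v = (\<lambda>(ls, c). f c * g (label_act ls c))"
  define W where "W = (\<lambda>ls. prod_list (map (label_weight E (single_weight h) (ring_weight h)) ls))"
  have h: "h > 0"
    using assms by simp
  have t: "real n * h = t"
    using assms by (simp add: h_def)
  have finI: "finite I"
    by (simp add: I_def finite_label_lists finite_E finite_configs finite_V)
  have A: "A x \<in> events" if "x \<in> I" for x
    using that prob_label_event(1)[OF h assms(2)] by (auto simp: A_def I_def)
  have disj: "disjoint_family_on A I"
    unfolding A_def I_def by (rule label_event_disjoint)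
  let ?F = "\<lambda>\<omega>. f (\<eta>0 \<omega>) * g (exclusion_config V E clock \<eta>0 t \<omega>)"
  have config: "exclusion_config V E clock \<eta>0 t \<omega> \<in> configs V" if "\<omega> \<in> space M" for \<omega>
    using initial_in_configs[OF that] by (rule exclusion_config_in_configs[OF graph])
  have F_bound: "\<bar>?F \<omega>\<bar> \<le> 1" if "\<omega> \<in> space M" for \<omega>
    using f[OF initial_in_configs[OF that]] g[OF config[OF that]] by (auto simp: abs_mult intro: mult_le_one)
  have meas: "?F \<in> borel_measurable M"
  proof (rule borel_measurable_times)
    show "(\<lambda>\<omega>. f (\<eta>0 \<omega>)) \<in> borel_measurable M"
      using simple_function_compose[OF simple_function_initial, of f]
      by (auto simp: comp_def intro: borel_measurable_simple_function)
  qed (rule config_measurable[OF assms(1)])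
  have int: "integrable M ?F"
    by (rule integrable_const_bound[of _ 1]) (use F_bound meas in auto)
  have F_event: "?F \<omega> * indicator (A x) \<omega> = v x * indicator (A x) \<omega>" if "x \<in> I" "\<omega> \<in> space M" for x \<omega>
  proof (cases "\<omega> \<in> A x")
    case True
    obtain ls c where x: "x = (ls, c)"
      by fastforce
    have "set ls \<subseteq> edge_labels E" "length ls = n" "follows_labels E clock h ls \<omega>" "\<eta>0 \<omega> = c"
      using True that by (auto simp: x A_def I_def label_lists_def label_event_def)
    then show ?thesis
      using exclusion_config_follows_labels[of V E clock \<omega> h ls \<eta>0, OF graph finite_rings[OF _ that(2)]]
        h initial_in_configs[OF that(2)] by (simp add: x v_def t)
  qed simp
  define U where "U = (\<Union>x\<in>I. A x)"
  have U: "U \<in> events"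
    unfolding U_def using finI A by (rule sets.finite_UN)
  have indicator_U: "indicator U \<omega> = (\<Sum>x\<in>I. indicator (A x) \<omega> :: real)" for \<omega>
    unfolding U_def by (rule indicator_UN_disjoint[OF finI disj])
  have int_A: "integrable M (\<lambda>\<omega>. v x * indicator (A x) \<omega>)" if "x \<in> I" for x
    using A[OF that] by (simp add: emeasure_eq_measure)
  have "expectation (\<lambda>\<omega>. ?F \<omega> * (1 - indicator U \<omega>)) = expectation (\<lambda>\<omega>. ?F \<omega> - (\<Sum>x\<in>I. v x * indicator (A x) \<omega>))"
  proof (rule Bochner_Integration.integral_cong[OF refl])
    fix \<omega> assume "\<omega> \<in> space M"
    then have "(\<Sum>x\<in>I. ?F \<omega> * indicator (A x) \<omega>) = (\<Sum>x\<in>I. v x * indicator (A x) \<omega>)"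
      by (intro sum.cong[OF refl] F_event)
    then show "?F \<omega> * (1 - indicator U \<omega>) = ?F \<omega> - (\<Sum>x\<in>I. v x * indicator (A x) \<omega>)"
      unfolding indicator_U right_diff_distrib sum_distrib_left by simp
  qed
  also have "\<dots> = expectation ?F - expectation (\<lambda>\<omega>. \<Sum>x\<in>I. v x * indicator (A x) \<omega>)"
    using int int_A by (intro Bochner_Integration.integral_diff Bochner_Integration.integrable_sum) auto
  also have "expectation (\<lambda>\<omega>. \<Sum>x\<in>I. v x * indicator (A x) \<omega>) = (\<Sum>x\<in>I. v x * prob (A x))"
    by (subst Bochner_Integration.integral_sum[OF int_A])
      (simp_all add: Int_absorb2 sets.sets_into_space[OF A])
  also have "(\<Sum>x\<in>I. v x * prob (A x))
      = single_weight h ^ n * config_inner V f ((lazy_average E (ring_weight h) ^^ n) g)"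
  proof -
    have "(\<Sum>x\<in>I. v x * prob (A x)) = (\<Sum>(ls, c)\<in>label_lists E n \<times> configs V.
        f c * g (label_act ls c) * (W ls / card (configs V)))"
      unfolding I_def by (rule sum.cong) (auto simp: v_def A_def W_def prob_label_event(2)[OF h assms(2)])
    also have "\<dots> = (\<Sum>c\<in>configs V. f c * (\<Sum>ls\<in>label_lists E n. W ls * g (label_act ls c)) / card (configs V))"
      by (subst sum.cartesian_product[symmetric], subst sum.swap)
        (simp add: sum_distrib_left sum_divide_distrib mult_ac)
    also have "\<dots> = single_weight h ^ n * config_inner V f ((lazy_average E (ring_weight h) ^^ n) g)"
      unfolding W_def sum_label_weight[OF finite_E]
      by (simp add: config_inner_def sum_distrib_left sum_divide_distrib mult_ac)
    finally show ?thesis .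
  qed
  finally have eq: "expectation (\<lambda>\<omega>. ?F \<omega> * (1 - indicator U \<omega>)) = expectation ?F -
    single_weight h ^ n * config_inner V f ((lazy_average E (ring_weight h) ^^ n) g)" .
  have "prob U = (\<Sum>x\<in>I. prob (A x))"
    unfolding U_def using A by (intro finite_measure_finite_Union[OF finI _ disj]) auto
  also have "\<dots> = (\<Sum>(ls, c)\<in>label_lists E n \<times> configs V. W ls / card (configs V))"
    unfolding I_def by (rule sum.cong) (auto simp: A_def W_def prob_label_event(2)[OF h assms(2)])
  also have "\<dots> = (\<Sum>c\<in>configs V. (\<Sum>ls\<in>label_lists E n. W ls) / card (configs V))"
    by (subst sum.cartesian_product[symmetric], subst sum.swap) (simp add: sum_divide_distrib)
  also have "\<dots> = (\<Sum>ls\<in>label_lists E n. W ls)"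
    using card_configs_pos[OF finite_V] by simp
  also have "\<dots> = single_weight h ^ n"
  proof -
    have const: "(lazy_average E (ring_weight h) ^^ n) (\<lambda>_. 1) = (\<lambda>_. 1)"
      by (rule lazy_average_power_const[OF _ finite_E]) (unfold ring_weight_def total_rate_def, simp)
    \<comment> \<open>The total weight is the path expansion of the constant 1, which the walk
      fixes; the starting configuration \<open>\<lambda>_. 0\<close> is arbitrary.\<close>
    show ?thesis
      using sum_label_weight[OF finite_E, of "single_weight h" "ring_weight h" "\<lambda>_. 1" "\<lambda>_. 0" n]
      unfolding W_def const by (simp only: mult_1_right)
  qed
  finally have prob_U: "prob U = single_weight h ^ n" .
  have "\<bar>expectation (\<lambda>\<omega>. ?F \<omega> * (1 - indicator U \<omega>))\<bar> \<le> expectation (\<lambda>\<omega>. 1 - indicator U \<omega>)"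
  proof (rule integral_abs_bound[THEN order_trans], rule integral_mono)
    show bound: "\<bar>?F \<omega> * (1 - indicator U \<omega>)\<bar> \<le> 1 - indicator U \<omega>" if "\<omega> \<in> space M" for \<omega>
      using F_bound[OF that] by (cases "\<omega> \<in> U") simp_all
    show int_U: "integrable M (\<lambda>\<omega>. 1 - indicator U \<omega> :: real)"
      using U by (simp add: emeasure_eq_measure)
    show "integrable M (\<lambda>\<omega>. \<bar>?F \<omega> * (1 - indicator U \<omega>)\<bar>)"
    proof (rule Bochner_Integration.integrable_bound[OF int_U])
      show "(\<lambda>\<omega>. \<bar>?F \<omega> * (1 - indicator U \<omega>)\<bar>) \<in> borel_measurable M"
        by (intro borel_measurable_abs borel_measurable_times[OF meas] borel_measurable_diff
          borel_measurable_const borel_measurable_indicator U)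
      show "AE \<omega> in M. norm \<bar>?F \<omega> * (1 - indicator U \<omega>)\<bar> \<le> norm (1 - indicator U \<omega> :: real)"
        unfolding real_norm_def abs_abs by (rule AE_I2) (rule order_trans[OF bound abs_ge_self])
    qed
  qed
  also have "\<dots> = 1 - prob U"
    using prob_compl[OF U] U by (simp add: emeasure_eq_measure prob_space Int_absorb2 sets.sets_into_space)
  also have "\<dots> = 1 - single_weight h ^ n"
    by (simp only: prob_U)
  finally show ?thesis
    unfolding eq .
qed

section \<open>Passage to the limit along fine grids\<close>

lemma single_weight_power_tendsto:
  "(\<lambda>n. single_weight (t / real n) ^ n) \<longlonglongrightarrow> 1"
proof -
  \<comment> \<open>For \<open>n > 0\<close> the exponential factors of the \<open>n\<close>
    intervals multiply to a constant, and the rest is the classical sequence for the exponential;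
    the two limits cancel.\<close>
  have "(\<lambda>n. exp (- (total_rate * t)) * (1 + total_rate * t / real n) ^ n)
      \<longlonglongrightarrow> exp (- (total_rate * t)) * exp (total_rate * t)"
    by (intro tendsto_mult tendsto_const tendsto_exp_limit_sequentially)
  moreover have "\<forall>\<^sub>F n in sequentially. exp (- (total_rate * t)) * (1 + total_rate * t / real n) ^ n
      = single_weight (t / real n) ^ n"
    using eventually_gt_at_top[of 0]
  proof eventually_elim
    case (elim n)
    then have "exp (- (total_rate * t)) = exp (- (total_rate * (t / real n))) ^ n"
      by (simp add: exp_of_nat_mult[symmetric])
    then show ?case
      by (simp add: single_weight_def power_mult_distrib)
  qed
  ultimately have "(\<lambda>n. single_weight (t / real n) ^ n)
      \<longlonglongrightarrow> exp (- (total_rate * t)) * exp (total_rate * t)"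
    by (rule Lim_transform_eventually)
  then show ?thesis
    by (simp add: exp_minus)
qed

lemma ring_weight_bounds:
  assumes "0 \<le> h"
  shows "0 \<le> ring_weight h" "ring_weight h \<le> 1"
  using mult_nonneg_nonneg[OF total_rate_nonneg assms] by (simp_all add: ring_weight_def)

lemma ring_weight_mono:
  assumes "0 \<le> h" "h \<le> h'"
  shows "ring_weight h \<le> ring_weight h'"
proof -
  have "0 \<le> total_rate * h" "total_rate * h \<le> total_rate * h'"
    using assms total_rate_nonneg by (auto intro: mult_left_mono)
  then show ?thesis
    by (simp add: ring_weight_def divide_simps) (simp add: algebra_simps)
qed

lemma expectation_tendsto:
  assumes "t > 0"
    and f: "\<And>c. c \<in> configs V \<Longrightarrow> \<bar>f c\<bar> \<le> 1" and g: "\<And>c. c \<in> configs V \<Longrightarrow> \<bar>g c\<bar> \<le> 1"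
  shows "(\<lambda>n. config_inner V f ((lazy_average E (ring_weight (t / real n)) ^^ n) g))
    \<longlonglongrightarrow> expectation (\<lambda>\<omega>. f (\<eta>0 \<omega>) * g (exclusion_config V E clock \<eta>0 t \<omega>))"
    (is "?I \<longlonglongrightarrow> ?e")
proof -
  let ?r = "\<lambda>n. single_weight (t / real n) ^ n"
  \<comment> \<open>Triangle inequality through \<open>?r n * ?I n\<close>: one term is the
    approximation error, the other comes from bounding \<open>?I n\<close> by 1.\<close>
  have "\<bar>?I n - ?e\<bar> \<le> 2 * (1 - ?r n)" if "n > 0" for n
  proof -
    have approx: "\<bar>?e - ?r n * ?I n\<bar> \<le> 1 - ?r n"
      by (rule expectation_approx[OF assms(1) that f g])
    then have "?r n \<le> 1"
      by linarith
    have "\<bar>(lazy_average E (ring_weight (t / real n)) ^^ n) g c\<bar> \<le> 1" if "c \<in> configs V" for c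
      using assms(1) by (intro lazy_average_power_bounded[OF graph _ _ g that] ring_weight_bounds) simp_all
    then have "\<bar>?I n\<bar> \<le> 1"
      by (intro config_inner_le_1[OF finite_V] f)
    then have "\<bar>(1 - ?r n) * ?I n\<bar> \<le> 1 - ?r n"
      using \<open>?r n \<le> 1\<close> by (simp add: abs_mult mult_left_le)
    with approx show ?thesis
      by (simp add: left_diff_distrib)
  qed
  then have "\<forall>\<^sub>F n in sequentially. norm (?I n - ?e) \<le> 2 * (1 - ?r n)"
    unfolding real_norm_def by (rule eventually_mono[OF eventually_gt_at_top[of 0]])
  moreover have "(\<lambda>n. 2 * (1 - ?r n)) \<longlonglongrightarrow> 2 * (1 - 1)"
    by (intro tendsto_intros single_weight_power_tendsto)
  ultimately have "(\<lambda>n. ?I n - ?e) \<longlonglongrightarrow> 0"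
    by (auto intro: Lim_null_comparison)
  then show ?thesis
    by (rule LIM_zero_cancel)
qed

lemma expectation_initial: "expectation (\<lambda>\<omega>. f (\<eta>0 \<omega>)) = config_inner V f (\<lambda>_. 1)"
proof -
  have "expectation (\<lambda>\<omega>. f (\<eta>0 \<omega>)) = integral\<^sup>L (distr M (count_space (configs V)) \<eta>0) f"
    by (rule integral_distr[symmetric, OF initial_measurable]) simp
  also have "distr M (count_space (configs V)) \<eta>0 = uniform_count_measure (configs V)"
    using process by (simp add: exclusion_process_def)
  also have "integral\<^sup>L \<dots> f = config_inner V f (\<lambda>_. 1)"
    by (simp add: integral_uniform_count_measure finite_configs finite_V config_inner_def)
  finally show ?thesis .
qed

end

section \<open>Monotonicity and convexity of the covariance\<close>

locale boolean_exclusion = exclusion M V E \<alpha> clock \<eta>0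
  for M :: "'w measure" and V :: "'v set" and E \<alpha> clock \<eta>0 +
  fixes f :: "('v \<Rightarrow> nat) \<Rightarrow> real"
  assumes boolean: "f \<in> configs V \<rightarrow> {-1, 1}"
begin

definition "centered = (\<lambda>c. f c - config_inner V f (\<lambda>_. 1))"

abbreviation "walk t n \<equiv> lazy_average E (ring_weight (t / real n))"
abbreviation "N \<equiv> exclusion_N M V E clock \<eta>0 f"

lemma f_bound: "c \<in> configs V \<Longrightarrow> \<bar>f c\<bar> \<le> 1"
  using funcset_mem[OF boolean, of c] by auto

lemma N_tendsto:
  assumes "t > 0"
  shows "(\<lambda>n. config_inner V centered ((walk t n ^^ n) centered)) \<longlonglongrightarrow> N t"
proof -
  have "E = {} \<Longrightarrow> ring_weight h = 0" for h
    unfolding ring_weight_def total_rate_def by simp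
  then have "config_inner V centered ((walk t n ^^ n) centered)
      = config_inner V f ((walk t n ^^ n) f) - (config_inner V f (\<lambda>_. 1))\<^sup>2" for n
    unfolding centered_def by (intro config_inner_centered[OF graph _ refl])
  moreover have "(\<lambda>n. config_inner V f ((walk t n ^^ n) f) - (config_inner V f (\<lambda>_. 1))\<^sup>2) \<longlonglongrightarrow> N t"
    unfolding exclusion_N_def expectation_initial
    by (intro tendsto_diff tendsto_const expectation_tendsto assms f_bound)
  ultimately show ?thesis
    by simp
qed

text \<open>Along even grid sizes the mesh \<open>t / (2 * n)\<close> equals
  \<open>(t / 2) / n\<close>. Hence the \<open>2 * n\<close> steps for time \<open>t\<close> are two
  runs of \<open>n\<close> steps for time \<open>t / 2\<close>, and symmetry yields a squared
  norm.\<close>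

lemma N_tendsto_norm:
  assumes "t > 0"
  shows "(\<lambda>n. config_inner V ((walk (t / 2) n ^^ n) centered) ((walk (t / 2) n ^^ n) centered)) \<longlonglongrightarrow> N t"
proof -
  have "(\<lambda>n. config_inner V centered ((walk t (2 * n) ^^ (2 * n)) centered)) \<longlonglongrightarrow> N t"
    by (rule filterlim_compose[OF N_tendsto[OF assms]])
      (auto simp: strict_mono_def intro!: filterlim_subseq)
  then show ?thesis
    by (simp add: lazy_average_power_double[OF graph])
qed

lemma centered_norm_le_1: "config_inner V centered centered \<le> 1"
proof -
  \<comment> \<open>The centring identity with zero steps: the squared norm is the variance, which
    is at most the second moment.\<close>
  have "config_inner V centered centered = config_inner V f f - (config_inner V f (\<lambda>_. 1))\<^sup>2"
    using config_inner_centered[OF graph _ refl, of 0 f 0] by (simp add: centered_def)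
  also have "\<dots> \<le> config_inner V f f"
    by simp
  also have "\<dots> \<le> 1"
    by (rule abs_le_D1[OF config_inner_le_1[OF finite_V f_bound f_bound]])
  finally show ?thesis .
qed

lemma N_nonneg:
  assumes "t > 0"
  shows "0 \<le> N t"
  by (rule LIMSEQ_le_const[OF N_tendsto_norm[OF assms]]) (simp add: config_inner_self_nonneg)

text \<open>Cauchy-Schwarz between \<open>centered\<close>, of norm at most 1, and its image under
  the walk up to time \<open>t / 2\<close>, whose squared norm tends to \<open>N t\<close>.\<close>

lemma N_half_power2_le:
  assumes "t > 0"
  shows "(N (t / 2))\<^sup>2 \<le> N t"
proof (rule LIMSEQ_le[OF tendsto_power[OF N_tendsto] N_tendsto_norm[OF assms]])
  let ?v = "\<lambda>n. (walk (t / 2) n ^^ n) centered"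
  have "(config_inner V centered (?v n))\<^sup>2 \<le> config_inner V (?v n) (?v n)" for n
  proof -
    have "(config_inner V centered (?v n))\<^sup>2 \<le> config_inner V centered centered * config_inner V (?v n) (?v n)"
      by (rule config_inner_Cauchy_Schwarz)
    also have "\<dots> \<le> 1 * config_inner V (?v n) (?v n)"
      by (intro mult_right_mono centered_norm_le_1 config_inner_self_nonneg)
    finally show ?thesis
      by simp
  qed
  then show "\<exists>N. \<forall>n\<ge>N. (config_inner V centered (?v n))\<^sup>2 \<le> config_inner V (?v n) (?v n)"
    by blast
qed (use assms in simp)

text \<open>Both values are limits of squared norms after the same number \<open>n\<close> of steps;
  the longer time only makes the steps less lazy.\<close>

lemma N_antimono:
  assumes "0 < s" "s \<le> t"
  shows "N t \<le> N s"
proof (rule LIMSEQ_le[OF N_tendsto_norm N_tendsto_norm])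
  \<comment> \<open>On fine grids the expected number of rings per interval is below 1, which puts
    the ring weight into the range up to \<open>1 / 2\<close> where the laziness comparison
    applies.\<close>
  have "(\<lambda>n. total_rate * (t / 2 / real n)) \<longlonglongrightarrow> total_rate * 0"
    by (intro tendsto_intros lim_const_over_n)
  then have "\<forall>\<^sub>F n in sequentially. total_rate * (t / 2 / real n) < 1"
    by (rule order_tendstoD(2)) simp
  then have "\<forall>\<^sub>F n in sequentially.
    config_inner V ((walk (t / 2) n ^^ n) centered) ((walk (t / 2) n ^^ n) centered)
      \<le> config_inner V ((walk (s / 2) n ^^ n) centered) ((walk (s / 2) n ^^ n) centered)"
  proof eventually_elim
    case (elim n)
    have "0 \<le> total_rate * (t / 2 / real n)"
      using assms total_rate_nonneg by simp
    with elim have "ring_weight (t / 2 / real n) \<le> 1 / 2"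
      unfolding ring_weight_def by (subst pos_divide_le_eq) simp_all
    moreover have "s / 2 / real n \<le> t / 2 / real n"
      using assms by (intro divide_right_mono) auto
    ultimately show ?case
      using assms by (intro lazy_average_power_antimono[OF graph] ring_weight_bounds ring_weight_mono) simp_all
  qed
  then show "\<exists>N. \<forall>n\<ge>N. config_inner V ((walk (t / 2) n ^^ n) centered) ((walk (t / 2) n ^^ n) centered)
      \<le> config_inner V ((walk (s / 2) n ^^ n) centered) ((walk (s / 2) n ^^ n) centered)"
    by (simp add: eventually_sequentially)
qed (use assms in simp_all)

end

section \<open>Transfer of convergence between two times\<close>

theorem proposition1p3:
  fixes V :: "nat \<Rightarrow> 'v set" and E :: "nat \<Rightarrow> 'v set set"
    and \<alpha> :: "nat \<Rightarrow> real"
    and f :: "nat \<Rightarrow> ('v \<Rightarrow> nat) \<Rightarrow> real"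
    and M :: "nat \<Rightarrow> 'w measure"
    and clock :: "nat \<Rightarrow> 'v set \<Rightarrow> 'w \<Rightarrow> real set"
    and \<eta>0 :: "nat \<Rightarrow> 'w \<Rightarrow> 'v \<Rightarrow> nat"
    and t s :: real
  assumes graphs: "\<And>n. finite_graph (V n) (E n)"
    and increasing: "mono V" "mono E"
    and rates: "\<And>n. \<alpha> n > 0"
    and boolean: "\<And>n. f n \<in> configs (V n) \<rightarrow> {-1, 1}"
    and processes: "\<And>n. exclusion_process (M n) (V n) (E n) (\<alpha> n) (clock n) (\<eta>0 n)"
    and times: "t > 0" "s > 0"
  shows "(\<lambda>n. exclusion_N (M n) (V n) (E n) (clock n) (\<eta>0 n) (f n) t) \<longlonglongrightarrow> 0 \<longleftrightarrow>
         (\<lambda>n. exclusion_N (M n) (V n) (E n) (clock n) (\<eta>0 n) (f n) s) \<longlonglongrightarrow> 0"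
proof -
  interpret boolean_exclusion "M n" "V n" "E n" "\<alpha> n" "clock n" "\<eta>0 n" "f n" for n
    by unfold_locales (fact graphs rates processes boolean)+
  let ?N = "\<lambda>t n. exclusion_N (M n) (V n) (E n) (clock n) (\<eta>0 n) (f n) t"
  \<comment> \<open>Stated for arbitrary positive times, so that both directions of the equivalence
    are instances.\<close>
  have transfer: "?N s \<longlonglongrightarrow> 0" if "?N t \<longlonglongrightarrow> 0" "t > 0" "s > 0" for t s
  proof -
    \<comment> \<open>Each halving of the time costs one square root, and convergence to 0 survives
      any fixed number of them.\<close>
    have "?N (t / 2 ^ k) \<longlonglongrightarrow> 0" for k
    proof (induction k)
      case (Suc k)
      have pos: "t / 2 ^ k > 0" and eq: "t / 2 ^ Suc k = t / 2 ^ k / 2"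
        using \<open>t > 0\<close> by simp_all
      show ?case
        unfolding eq
      proof (rule tendsto_sandwich[OF _ _ tendsto_const])
        show "\<forall>\<^sub>F n in sequentially. 0 \<le> ?N (t / 2 ^ k / 2) n"
          by (intro always_eventually allI N_nonneg half_gt_zero pos)
        show "\<forall>\<^sub>F n in sequentially. ?N (t / 2 ^ k / 2) n \<le> sqrt (?N (t / 2 ^ k) n)"
          by (intro always_eventually allI real_le_rsqrt N_half_power2_le pos)
        show "(\<lambda>n. sqrt (?N (t / 2 ^ k) n)) \<longlonglongrightarrow> 0"
          using tendsto_real_sqrt[OF Suc] by simp
      qed
    qed (use that in simp)
    note null = this
    \<comment> \<open>The number of halvings depends on \<open>t\<close> and \<open>s\<close> only,
      not on the index of the graph; once \<open>t / 2 ^ k\<close> is at most \<open>s\<close>,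
      monotonicity in time finishes the argument.\<close>
    obtain k where "t / s < 2 ^ k"
      using real_arch_pow[of 2] by auto
    then have k: "0 < t / 2 ^ k" "t / 2 ^ k \<le> s"
      using \<open>s > 0\<close> \<open>t > 0\<close> by (simp_all add: field_simps less_imp_le)
    show ?thesis
    proof (rule tendsto_sandwich[OF _ _ tendsto_const null])
      show "\<forall>\<^sub>F n in sequentially. 0 \<le> ?N s n"
        by (intro always_eventually allI N_nonneg \<open>s > 0\<close>)
      show "\<forall>\<^sub>F n in sequentially. ?N s n \<le> ?N (t / 2 ^ k) n"
        by (intro always_eventually allI N_antimono k)
    qed
  qed
  show ?thesis
    using transfer times by blast
qed

end
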